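(* Let $T$ be a consistent RE theory and $n\geq1$. If $T$ is $n$-Rosser, then $T$ is effectively inseparable. Consequently, if $T$ is Rosser, then $T$ is effectively inseparable.
   Context: $W_i$ denotes the RE set with index $i$. A disjoint pair $(A,B)$ of RE sets is effectively inseparable if there is a recursive $f(x,y)$ such that for all $i,j$, if $A\subseteq W_i$, $B\subseteq W_j$ and $W_i\cap W_j=\emptyset$ then $f(i,j)\notin W_i\cup W_j$. $T$ is effectively inseparable if $(T_P,T_R)$ is, where $T_P=\{\ulcorner\phi\urcorner: T\vdash\phi\}$ and $T_R=\{\ulcorner\phi\urcorner:T\vdash\neg\phi\}$ (for sentences $\phi$, under a fixed Gödel numbering). ${\sf Num}$ is the theory in $\{\mathbf 0,\mathbf S\}$ with axioms $\overline m\neq\overline n$ for $m\neq n$, $\overline 0=\mathbf 0$, $\overline{k+1}=\mathbf S\overline k$. An interpretation $I:{\sf Num}\unlhd T$ is a translation of the language of ${\sf Num}$ into that of $T$ such that $T$ proves totality of translated function symbols on the domain, the translations of all theorems of ${\sf Num}$ and of the equality axioms; $\overline a^I$ is the $I$-translation of $\overline a$. A formula $\phi(x_1,\dots,x_n)$ with exactly $n$ free variables strongly separates $M_1$ from $M_2$ in $T$ w.r.t. $I$ if $\vec a\in M_1\Rightarrow T\vdash\phi(\overline{a_1}^I,\dots,\overline{a_n}^I)$ and $\vec a\in M_2\Rightarrow T\vdash\neg\phi(\overline{a_1}^I,\dots,\overline{a_n}^I)$. $T$ is $n$-Rosser if there is $I$ such that for every pair of $n$-ary RE relations $M_1,M_2$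 some formula strongly separates $M_1\setminus M_2$ from $M_2\setminus M_1$ w.r.t. $I$; $T$ is Rosser if it is $n$-Rosser for every $n\ge1$. *)

theory Defs
  imports Main "HOL-Library.Nat_Bijection"
begin

section \<open>Partial recursive functions and RE sets\<close>

text \<open>
  Unary partial recursive functions; functions and relations of several arguments are handled
  through the bijective pairing \<^term>\<open>prod_encode\<close> and the tupling \<^term>\<open>list_encode\<close>.
  The identity is \<open>Pair Fst Snd\<close>, as the pairing is bijective.
\<close>

datatype prog =
  Zero | Succ | Fst | Snd | Pair prog prog | Comp prog prog | Prec prog prog | Mn prog

inductive computes :: "prog \<Rightarrow> nat \<Rightarrow> nat \<Rightarrow> bool" where
  zero: "computes Zero x 0"
| succ: "computes Succ x (Suc x)"
| fst: "computes Fst (prod_encode (x, y)) x"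
| snd: "computes Snd (prod_encode (x, y)) y"
| pair: "computes p x u \<Longrightarrow> computes q x v \<Longrightarrow> computes (Pair p q) x (prod_encode (u, v))"
| comp: "computes q x u \<Longrightarrow> computes p u v \<Longrightarrow> computes (Comp p q) x v"
| prec_0: "computes p x v \<Longrightarrow> computes (Prec p q) (prod_encode (x, 0)) v"
| prec_Suc: "computes (Prec p q) (prod_encode (x, k)) u \<Longrightarrow>
    computes q (prod_encode (x, prod_encode (k, u))) v \<Longrightarrow>
    computes (Prec p q) (prod_encode (x, Suc k)) v"
| mn: "computes p (prod_encode (x, k)) 0 \<Longrightarrow>
    (\<forall>m<k. \<exists>v. computes p (prod_encode (x, m)) (Suc v)) \<Longrightarrow>
    computes (Mn p) x k"

primrec prog_code :: "prog \<Rightarrow> nat" where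
  "prog_code Zero = prod_encode (0, 0)"
| "prog_code Succ = prod_encode (1, 0)"
| "prog_code Fst = prod_encode (2, 0)"
| "prog_code Snd = prod_encode (3, 0)"
| "prog_code (Pair p q) = prod_encode (4, prod_encode (prog_code p, prog_code q))"
| "prog_code (Comp p q) = prod_encode (5, prod_encode (prog_code p, prog_code q))"
| "prog_code (Prec p q) = prod_encode (6, prod_encode (prog_code p, prog_code q))"
| "prog_code (Mn p) = prod_encode (7, prog_code p)"

text \<open>
  \<open>W i\<close> is the domain of the partial recursive function with index \<open>i\<close>. The coding of programs is
  injective; a number that codes no program is an index of the empty set.
\<close>

definition W :: "nat \<Rightarrow> nat set" where
  "W i = {x. \<exists>p y. prog_code p = i \<and> computes p x y}"

definition RE :: "nat set \<Rightarrow> bool" where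
  "RE A \<longleftrightarrow> (\<exists>i. A = W i)"

definition RE_rel :: "nat \<Rightarrow> nat list set \<Rightarrow> bool" where
  "RE_rel n M \<longleftrightarrow> M \<subseteq> {as. length as = n} \<and> RE (list_encode ` M)"

definition recursive2 :: "(nat \<Rightarrow> nat \<Rightarrow> nat) \<Rightarrow> bool" where
  "recursive2 f \<longleftrightarrow> (\<exists>p. \<forall>x y. computes p (prod_encode (x, y)) (f x y))"

definition recursive_set :: "nat set \<Rightarrow> bool" where
  "recursive_set A \<longleftrightarrow> (\<exists>p. \<forall>x. computes p x (if x \<in> A then 1 else 0))"

definition effectively_inseparable :: "nat set \<Rightarrow> nat set \<Rightarrow> bool" where
  "effectively_inseparable A B \<longleftrightarrow> RE A \<and> RE B \<and> A \<inter> B = {} \<and>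
    (\<exists>f. recursive2 f \<and>
      (\<forall>i j. A \<subseteq> W i \<longrightarrow> B \<subseteq> W j \<longrightarrow> W i \<inter> W j = {} \<longrightarrow> f i j \<notin> W i \<union> W j))"


section \<open>First-order logic with equality\<close>

text \<open>
  Variables are de Bruijn indices. Non-logical symbols are natural numbers; a symbol used with
  \<open>k\<close> arguments is identified with the pair of its number and the arity \<open>k\<close>.
\<close>

datatype tm = Var nat | Fun nat "tm list"

datatype fm = Bot | Eq tm tm | Rel nat "tm list" | Imp fm fm | All fm

abbreviation Neg :: "fm \<Rightarrow> fm" where "Neg \<phi> \<equiv> Imp \<phi> Bot"
abbreviation And :: "fm \<Rightarrow> fm \<Rightarrow> fm" where "And \<phi> \<psi> \<equiv> Neg (Imp \<phi> (Neg \<psi>))"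
abbreviation Ex :: "fm \<Rightarrow> fm" where "Ex \<phi> \<equiv> Neg (All (Neg \<phi>))"

fun fv_tm :: "tm \<Rightarrow> nat set" where
  "fv_tm (Var i) = {i}"
| "fv_tm (Fun f ts) = (\<Union>t\<in>set ts. fv_tm t)"

primrec fv :: "fm \<Rightarrow> nat set" where
  "fv Bot = {}"
| "fv (Eq s t) = fv_tm s \<union> fv_tm t"
| "fv (Rel r ts) = (\<Union>t\<in>set ts. fv_tm t)"
| "fv (Imp \<phi> \<psi>) = fv \<phi> \<union> fv \<psi>"
| "fv (All \<phi>) = {i. Suc i \<in> fv \<phi>}"

record lang =
  funs :: "(nat \<times> nat) set"
  rels :: "(nat \<times> nat) set"

fun tm_in :: "lang \<Rightarrow> tm \<Rightarrow> bool" where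
  "tm_in L (Var i) \<longleftrightarrow> True"
| "tm_in L (Fun f ts) \<longleftrightarrow> (f, length ts) \<in> funs L \<and> (\<forall>t\<in>set ts. tm_in L t)"

primrec fm_in :: "lang \<Rightarrow> fm \<Rightarrow> bool" where
  "fm_in L Bot \<longleftrightarrow> True"
| "fm_in L (Eq s t) \<longleftrightarrow> tm_in L s \<and> tm_in L t"
| "fm_in L (Rel r ts) \<longleftrightarrow> (r, length ts) \<in> rels L \<and> (\<forall>t\<in>set ts. tm_in L t)"
| "fm_in L (Imp \<phi> \<psi>) \<longleftrightarrow> fm_in L \<phi> \<and> fm_in L \<psi>"
| "fm_in L (All \<phi>) \<longleftrightarrow> fm_in L \<phi>"

definition sentence :: "lang \<Rightarrow> fm \<Rightarrow> bool" where
  "sentence L \<phi> \<longleftrightarrow> fm_in L \<phi> \<and> fv \<phi> = {}"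

primrec lift_tm :: "nat \<Rightarrow> tm \<Rightarrow> tm" where
  "lift_tm k (Var i) = Var (if i < k then i else Suc i)"
| "lift_tm k (Fun f ts) = Fun f (map (lift_tm k) ts)"

primrec lift :: "nat \<Rightarrow> fm \<Rightarrow> fm" where
  "lift k Bot = Bot"
| "lift k (Eq s t) = Eq (lift_tm k s) (lift_tm k t)"
| "lift k (Rel r ts) = Rel r (map (lift_tm k) ts)"
| "lift k (Imp \<phi> \<psi>) = Imp (lift k \<phi>) (lift k \<psi>)"
| "lift k (All \<phi>) = All (lift (Suc k) \<phi>)"

primrec subst_tm :: "nat \<Rightarrow> tm \<Rightarrow> tm \<Rightarrow> tm" where
  "subst_tm k s (Var i) = (if i < k then Var i else if i = k then s else Var (i - 1))"
| "subst_tm k s (Fun f ts) = Fun f (map (subst_tm k s) ts)"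

primrec subst :: "nat \<Rightarrow> tm \<Rightarrow> fm \<Rightarrow> fm" where
  "subst k s Bot = Bot"
| "subst k s (Eq t u) = Eq (subst_tm k s t) (subst_tm k s u)"
| "subst k s (Rel r ts) = Rel r (map (subst_tm k s) ts)"
| "subst k s (Imp \<phi> \<psi>) = Imp (subst k s \<phi>) (subst k s \<psi>)"
| "subst k s (All \<phi>) = All (subst (Suc k) (lift_tm 0 s) \<phi>)"

text \<open>
  A Hilbert calculus, restricted to formulas of the language \<open>L\<close>. The rule \<open>gen\<close> is unrestricted
  because it is used only for sets \<open>T\<close> of sentences.
\<close>

inductive provable :: "lang \<Rightarrow> fm set \<Rightarrow> fm \<Rightarrow> bool" for L :: lang and T :: "fm set" where
  ax: "\<phi> \<in> T \<Longrightarrow> provable L T \<phi>"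
| imp_K: "fm_in L \<phi> \<Longrightarrow> fm_in L \<psi> \<Longrightarrow> provable L T (Imp \<phi> (Imp \<psi> \<phi>))"
| imp_S: "fm_in L \<phi> \<Longrightarrow> fm_in L \<psi> \<Longrightarrow> fm_in L \<chi> \<Longrightarrow>
    provable L T (Imp (Imp \<phi> (Imp \<psi> \<chi>)) (Imp (Imp \<phi> \<psi>) (Imp \<phi> \<chi>)))"
| dneg: "fm_in L \<phi> \<Longrightarrow> provable L T (Imp (Neg (Neg \<phi>)) \<phi>)"
| all_inst: "fm_in L \<phi> \<Longrightarrow> tm_in L t \<Longrightarrow> provable L T (Imp (All \<phi>) (subst 0 t \<phi>))"
| all_imp: "fm_in L \<phi> \<Longrightarrow> fm_in L \<psi> \<Longrightarrow>
    provable L T (Imp (All (Imp \<phi> \<psi>)) (Imp (All \<phi>) (All \<psi>)))"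
| all_vac: "fm_in L \<phi> \<Longrightarrow> provable L T (Imp \<phi> (All (lift 0 \<phi>)))"
| eq_refl: "tm_in L t \<Longrightarrow> provable L T (Eq t t)"
| eq_subst: "fm_in L \<phi> \<Longrightarrow> tm_in L s \<Longrightarrow> tm_in L t \<Longrightarrow>
    provable L T (Imp (Eq s t) (Imp (subst 0 s \<phi>) (subst 0 t \<phi>)))"
| mp: "provable L T (Imp \<phi> \<psi>) \<Longrightarrow> provable L T \<phi> \<Longrightarrow> provable L T \<psi>"
| gen: "provable L T \<phi> \<Longrightarrow> provable L T (All \<phi>)"

primrec gn_tm :: "tm \<Rightarrow> nat" where
  "gn_tm (Var i) = prod_encode (0, i)"
| "gn_tm (Fun f ts) = prod_encode (1, prod_encode (f, list_encode (map gn_tm ts)))"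

primrec gn :: "fm \<Rightarrow> nat" where
  "gn Bot = prod_encode (0, 0)"
| "gn (Eq s t) = prod_encode (1, prod_encode (gn_tm s, gn_tm t))"
| "gn (Rel r ts) = prod_encode (2, prod_encode (r, list_encode (map gn_tm ts)))"
| "gn (Imp \<phi> \<psi>) = prod_encode (3, prod_encode (gn \<phi>, gn \<psi>))"
| "gn (All \<phi>) = prod_encode (4, gn \<phi>)"


section \<open>Theories\<close>

definition recursive_lang :: "lang \<Rightarrow> bool" where
  "recursive_lang L \<longleftrightarrow>
    recursive_set (prod_encode ` funs L) \<and> recursive_set (prod_encode ` rels L)"

text \<open>A theory is given by its language and a set of sentences, its axioms.\<close>

definition RE_theory :: "lang \<Rightarrow> fm set \<Rightarrow> bool" where
  "RE_theory L T \<longleftrightarrow> recursive_lang L \<and> (\<forall>\<phi>\<in>T. sentence L \<phi>) \<and> RE (gn ` T)"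

definition consistent :: "lang \<Rightarrow> fm set \<Rightarrow> bool" where
  "consistent L T \<longleftrightarrow> \<not> provable L T Bot"

definition provables :: "lang \<Rightarrow> fm set \<Rightarrow> nat set" where
  "provables L T = {gn \<phi> |\<phi>. sentence L \<phi> \<and> provable L T \<phi>}"

definition refutables :: "lang \<Rightarrow> fm set \<Rightarrow> nat set" where
  "refutables L T = {gn \<phi> |\<phi>. sentence L \<phi> \<and> provable L T (Neg \<phi>)}"

definition EI_theory :: "lang \<Rightarrow> fm set \<Rightarrow> bool" where
  "EI_theory L T \<longleftrightarrow> effectively_inseparable (provables L T) (refutables L T)"


section \<open>The theory Num and its interpretations\<close>

abbreviation Zero_tm :: tm where "Zero_tm \<equiv> Fun 0 []"
abbreviation Succ_tm :: "tm \<Rightarrow> tm" where "Succ_tm t \<equiv> Fun (Suc 0) [t]"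

primrec numeral_tm :: "nat \<Rightarrow> tm" where
  "numeral_tm 0 = Zero_tm"
| "numeral_tm (Suc k) = Succ_tm (numeral_tm k)"

definition Num_lang :: lang where
  "Num_lang = \<lparr>funs = {(0, 0), (Suc 0, Suc 0)}, rels = {}\<rparr>"

text \<open>The defining equations of the numerals in Num hold by the definition of \<^const>\<open>numeral_tm\<close>.\<close>

definition Num :: "fm set" where
  "Num = {Neg (Eq (numeral_tm m) (numeral_tm n)) |m n. m \<noteq> n}"

text \<open>Simultaneous renaming of free variables; \<open>at \<phi> xs\<close> puts the variable \<open>xs ! i\<close> for \<open>i\<close>.\<close>

primrec ren_tm :: "(nat \<Rightarrow> nat) \<Rightarrow> tm \<Rightarrow> tm" where
  "ren_tm r (Var i) = Var (r i)"
| "ren_tm r (Fun f ts) = Fun f (map (ren_tm r) ts)"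

primrec ren :: "(nat \<Rightarrow> nat) \<Rightarrow> fm \<Rightarrow> fm" where
  "ren r Bot = Bot"
| "ren r (Eq s t) = Eq (ren_tm r s) (ren_tm r t)"
| "ren r (Rel p ts) = Rel p (map (ren_tm r) ts)"
| "ren r (Imp \<phi> \<psi>) = Imp (ren r \<phi>) (ren r \<psi>)"
| "ren r (All \<phi>) = All (ren (case_nat 0 (\<lambda>i. Suc (r i))) \<phi>)"

definition at :: "fm \<Rightarrow> nat list \<Rightarrow> fm" where
  "at \<phi> xs = ren (\<lambda>i. xs ! i) \<phi>"

text \<open>
  A (one-dimensional, parameter-free, relativised) translation of the language of Num:
  the domain \<open>\<delta>(x\<^sub>0)\<close>, equality \<open>x\<^sub>0 = x\<^sub>1\<close>, the graph \<open>0 = x\<^sub>0\<close>, and the graph \<open>S x\<^sub>0 = x\<^sub>1\<close>.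
\<close>

record translation =
  tr_dom :: fm
  tr_eq :: fm
  tr_zero :: fm
  tr_succ :: fm

definition translation_into :: "lang \<Rightarrow> translation \<Rightarrow> bool" where
  "translation_into L I \<longleftrightarrow>
    fm_in L (tr_dom I) \<and> fv (tr_dom I) \<subseteq> {0} \<and>
    fm_in L (tr_eq I) \<and> fv (tr_eq I) \<subseteq> {0, 1} \<and>
    fm_in L (tr_zero I) \<and> fv (tr_zero I) \<subseteq> {0} \<and>
    fm_in L (tr_succ I) \<and> fv (tr_succ I) \<subseteq> {0, 1}"

text \<open>
  \<open>val I d t y\<close> is the translation of \<open>t = y\<close>, with nested occurrences of function symbols
  eliminated by quantifiers over the domain; a variable in place of \<open>t\<close> is simply identified with
  \<open>y\<close>, by the equality of the target theory rather than by \<open>tr_eq\<close>, which amounts to not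
  eliminating it; the variables of \<open>t\<close> are shifted by the number \<open>d\<close>
  of quantifiers introduced so far. The last equation of \<open>val\<close> and the \<open>Rel\<close> equation of
  \<open>tr\<close> concern expressions outside the language of Num and are irrelevant.
\<close>

fun val :: "translation \<Rightarrow> nat \<Rightarrow> tm \<Rightarrow> nat \<Rightarrow> fm" where
  "val I d (Var i) y = Eq (Var (i + d)) (Var y)"
| "val I d (Fun 0 []) y = at (tr_zero I) [y]"
| "val I d (Fun (Suc 0) [t]) y =
    Ex (And (at (tr_dom I) [0]) (And (val I (Suc d) t 0) (at (tr_succ I) [0, Suc y])))"
| "val I d (Fun f ts) y = Bot"

primrec tr :: "translation \<Rightarrow> fm \<Rightarrow> fm" where
  "tr I Bot = Bot"
| "tr I (Eq s t) =
    Ex (And (at (tr_dom I) [0]) (And (val I 1 s 0)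
      (Ex (And (at (tr_dom I) [0]) (And (val I 2 t 0) (at (tr_eq I) [1, 0]))))))"
| "tr I (Rel r ts) = Bot"
| "tr I (Imp \<phi> \<psi>) = Imp (tr I \<phi>) (tr I \<psi>)"
| "tr I (All \<phi>) = All (Imp (at (tr_dom I) [0]) (tr I \<phi>))"

text \<open>
  The equality axioms are imposed directly on the translated equality and graphs, so that the
  choice made above of how to eliminate nested terms is immaterial up to provability in \<open>T\<close>.
\<close>

definition eq_axioms :: "translation \<Rightarrow> fm set" where
  "eq_axioms I = (let D = (\<lambda>x. at (tr_dom I) [x]); E = (\<lambda>x y. at (tr_eq I) [x, y]);
      Z = (\<lambda>x. at (tr_zero I) [x]); S = (\<lambda>x y. at (tr_succ I) [x, y]) in
    {All (Imp (D 0) (E 0 0)),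
     All (All (Imp (D 1) (Imp (D 0) (Imp (E 1 0) (E 0 1))))),
     All (All (All (Imp (D 2) (Imp (D 1) (Imp (D 0) (Imp (E 2 1) (Imp (E 1 0) (E 2 0)))))))),
     All (All (Imp (D 1) (Imp (D 0) (Imp (E 1 0) (Imp (Z 1) (Z 0)))))),
     All (All (All (All (Imp (D 3) (Imp (D 2) (Imp (D 1) (Imp (D 0)
       (Imp (E 3 2) (Imp (E 1 0) (Imp (S 3 1) (S 2 0)))))))))))})"

definition totality_axioms :: "translation \<Rightarrow> fm set" where
  "totality_axioms I =
    {Ex (And (at (tr_dom I) [0]) (at (tr_zero I) [0])),
     All (Imp (at (tr_dom I) [0]) (Ex (And (at (tr_dom I) [0]) (at (tr_succ I) [1, 0]))))}"

definition interprets_Num :: "lang \<Rightarrow> fm set \<Rightarrow> translation \<Rightarrow> bool" where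
  "interprets_Num L T I \<longleftrightarrow> translation_into L I \<and>
    (\<forall>\<phi>\<in>totality_axioms I. provable L T \<phi>) \<and>
    (\<forall>\<phi>\<in>eq_axioms I. provable L T \<phi>) \<and>
    (\<forall>\<phi>. sentence Num_lang \<phi> \<longrightarrow> provable Num_lang Num \<phi> \<longrightarrow> provable L T (tr I \<phi>))"


section \<open>Strong separation and Rosser theories\<close>

text \<open>
  The translation of a numeral is the formula \<open>val I 0 (numeral_tm a) y\<close> defining its value. Hence
  \<open>num_inst I \<phi> as\<close>, that is \<open>\<phi>\<close> applied to the translated numerals of \<open>as\<close>, is the sentence
  \<open>\<exists>x\<^sub>0 \<dots> x\<^sub>n\<^sub>-\<^sub>1. (\<And>i<n. \<delta>(x\<^sub>i) \<and> x\<^sub>i is a value of the numeral of as ! i) \<and> \<phi>(x\<^sub>0, \<dots>, x\<^sub>n\<^sub>-\<^sub>1)\<close>.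
\<close>

definition num_inst :: "translation \<Rightarrow> fm \<Rightarrow> nat list \<Rightarrow> fm" where
  "num_inst I \<phi> as = (Ex ^^ length as)
    (foldr (\<lambda>i \<psi>. And (And (at (tr_dom I) [i]) (val I 0 (numeral_tm (as ! i)) i)) \<psi>)
      [0..<length as] \<phi>)"

definition strongly_separates ::
    "lang \<Rightarrow> fm set \<Rightarrow> translation \<Rightarrow> nat \<Rightarrow> fm \<Rightarrow> nat list set \<Rightarrow> nat list set \<Rightarrow> bool" where
  "strongly_separates L T I n \<phi> M1 M2 \<longleftrightarrow> fm_in L \<phi> \<and> fv \<phi> = {..<n} \<and>
    (\<forall>as. length as = n \<longrightarrow>
      (as \<in> M1 \<longrightarrow> provable L T (num_inst I \<phi> as)) \<and>
      (as \<in> M2 \<longrightarrow> provable L T (Neg (num_inst I \<phi> as))))"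

definition n_Rosser :: "lang \<Rightarrow> fm set \<Rightarrow> nat \<Rightarrow> bool" where
  "n_Rosser L T n \<longleftrightarrow> (\<exists>I. interprets_Num L T I \<and>
    (\<forall>M1 M2. RE_rel n M1 \<longrightarrow> RE_rel n M2 \<longrightarrow>
      (\<exists>\<phi>. strongly_separates L T I n \<phi> (M1 - M2) (M2 - M1))))"

definition Rosser :: "lang \<Rightarrow> fm set \<Rightarrow> bool" where
  "Rosser L T \<longleftrightarrow> (\<forall>n\<ge>1. n_Rosser L T n)"

end

theory Submission
  imports Defs "HOL-Library.Infinite_Set"
begin

text \<open>
  Fix an interpretation \<open>I\<close> witnessing that \<open>T\<close> is \<open>n\<close>-Rosser. For a formula \<open>\<phi>\<close> with code \<open>e\<close>, let
  \<open>\<theta>\<close> be the instance of \<open>\<phi>\<close> at the numerals of \<open>\<langle>e, i, j\<rangle>, 0, \<dots>, 0\<close>; its code is a recursive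
  function of \<open>e, i, j\<close>. Let \<open>M1\<close> and \<open>M2\<close> be the RE relations saying of such a tuple that the code of
  \<open>\<theta>\<close> is in \<open>W j\<close>, respectively in \<open>W i\<close>, and let \<open>\<phi>\<close> separate \<open>M1 - M2\<close> from \<open>M2 - M1\<close>. If
  \<open>W i \<supseteq> T\<^sub>P\<close> and \<open>W j \<supseteq> T\<^sub>R\<close> are disjoint and \<open>\<theta>\<close> is in \<open>W i\<close>, then \<open>T\<close> refutes \<open>\<theta>\<close>, so \<open>\<theta>\<close> is in
  \<open>W j\<close>; symmetrically if it is in \<open>W j\<close>. So \<open>\<theta>\<close> is in neither.

  The argument needs that \<open>x \<in> W i\<close> is RE in \<open>(i, x)\<close> and that \<open>T\<^sub>P\<close> and \<open>T\<^sub>R\<close> are RE. Both follow from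
  one principle: the least fixed point of an enumeration operator is RE, because membership means
  that a finite derivation sequence exists. Enumeration operators are closed under the
  positive connectives, existential and bounded universal quantifiers, so computations, the graphs
  of substitution and lifting on codes, and provability are all covered by reading off their rules.
\<close>


section \<open>Total recursive functions\<close>

abbreviation pr :: "nat \<Rightarrow> nat \<Rightarrow> nat" where "pr x y \<equiv> prod_encode (x, y)"

definition pfst :: "nat \<Rightarrow> nat" where "pfst z = fst (prod_decode z)"
definition psnd :: "nat \<Rightarrow> nat" where "psnd z = snd (prod_decode z)"

lemma pfst_pr [simp]: "pfst (pr x y) = x"
  and psnd_pr [simp]: "psnd (pr x y) = y"
  and pr_proj [simp]: "pr (pfst z) (psnd z) = z"
  by (simp_all add: pfst_def psnd_def)

lemma pr_cases: obtains x y where "z = pr x y"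
  by (metis pr_proj)

inductive_cases computes_ZeroE: "computes Zero x y"
inductive_cases computes_SuccE: "computes Succ x y"
inductive_cases computes_FstE: "computes Fst x y"
inductive_cases computes_SndE: "computes Snd x y"
inductive_cases computes_PairE: "computes (Pair p q) x y"
inductive_cases computes_CompE: "computes (Comp p q) x y"
inductive_cases computes_PrecE: "computes (Prec p q) x y"
inductive_cases computes_MnE: "computes (Mn p) x y"

text \<open>Induction on the first computation. In the \<open>Mn\<close> case, if one result were
  smaller than the other, \<open>p\<close> would give 0 there by one computation and a successor by
  the other.\<close>

lemma computes_unique: "computes p x y \<Longrightarrow> computes p x z \<Longrightarrow> y = z"
proof (induction arbitrary: z rule: computes.induct)
  case (zero x) then show ?case by (auto elim: computes_ZeroE)
next
  case (succ x) then show ?case by (auto elim: computes_SuccE)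
next
  case (fst x y) then show ?case by (auto elim: computes_FstE)
next
  case (snd x y) then show ?case by (auto elim: computes_SndE)
next
  case (pair p x u q v) then show ?case by (metis computes_PairE)
next
  case (comp q x u p v) then show ?case by (metis computes_CompE)
next
  case (prec_0 p x v q)
  from prec_0.prems show ?case by (rule computes_PrecE) (use prec_0.IH in auto)
next
  case (prec_Suc p q x k u v)
  from prec_Suc.prems show ?case
    by (rule computes_PrecE) (use prec_Suc.IH in auto)
next
  case (mn p x k)
  from mn.prems obtain A: "computes p (pr x z) 0" and B: "\<forall>m<z. \<exists>v. computes p (pr x m) (Suc v)"
    by (rule computes_MnE) auto
  have "\<not> z < k" using mn.IH(2) A by fastforce
  moreover have "\<not> k < z" using mn.IH(1) B by fastforce
  ultimately show ?case by simp
qed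

definition recursive1 :: "(nat \<Rightarrow> nat) \<Rightarrow> bool" where
  "recursive1 f \<longleftrightarrow> (\<exists>p. \<forall>x. computes p x (f x))"

lemma recursive1_id: "recursive1 (\<lambda>x. x)"
proof -
  have "computes (Pair Fst Snd) x x" for x
    by (metis computes.fst computes.pair computes.snd pr_cases)
  then show ?thesis unfolding recursive1_def by blast
qed

lemma recursive1_comp: "recursive1 f \<Longrightarrow> recursive1 g \<Longrightarrow> recursive1 (\<lambda>x. f (g x))"
  unfolding recursive1_def by (meson computes.comp)

lemma recursive1_Suc: "recursive1 f \<Longrightarrow> recursive1 (\<lambda>x. Suc (f x))"
  unfolding recursive1_def by (meson computes.comp computes.succ)

lemma recursive1_const: "recursive1 (\<lambda>x. c)"
proof (induction c)
  case 0 show ?case unfolding recursive1_def by (meson computes.zero)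
next
  case (Suc c) then show ?case by (rule recursive1_Suc)
qed

lemma recursive1_pfst: "recursive1 f \<Longrightarrow> recursive1 (\<lambda>x. pfst (f x))"
proof (rule recursive1_comp[of pfst])
  have "computes Fst x (pfst x)" for x by (metis computes.fst pr_proj)
  then show "recursive1 pfst" unfolding recursive1_def by blast
qed

lemma recursive1_psnd: "recursive1 f \<Longrightarrow> recursive1 (\<lambda>x. psnd (f x))"
proof (rule recursive1_comp[of psnd])
  have "computes Snd x (psnd x)" for x by (metis computes.snd pr_proj)
  then show "recursive1 psnd" unfolding recursive1_def by blast
qed

lemma recursive1_pr: "recursive1 f \<Longrightarrow> recursive1 g \<Longrightarrow> recursive1 (\<lambda>x. pr (f x) (g x))"
  unfolding recursive1_def by (meson computes.pair)

text \<open>\<open>Prec\<close> keeps the parameter \<open>x\<close> fixed and hands its step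
  program the counter and the previous value as one pair, hence the nested projections in the
  hypothesis on \<open>h\<close>. Running it on \<open>pr x (n x)\<close> lets \<open>x\<close> be
  both the parameter and the source of the count.\<close>

lemma recursive1_rec:
  assumes g: "recursive1 g" and h: "recursive1 (\<lambda>z. h (pfst z) (pfst (psnd z)) (psnd (psnd z)))"
    and n: "recursive1 n"
  shows "recursive1 (\<lambda>x. rec_nat (g x) (h x) (n x))"
proof -
  obtain p where p: "\<And>x. computes p x (g x)" using g unfolding recursive1_def by blast
  obtain q where q: "\<And>z. computes q z (h (pfst z) (pfst (psnd z)) (psnd (psnd z)))"
    using h unfolding recursive1_def by blast
  have "computes (Prec p q) (pr x k) (rec_nat (g x) (h x) k)" for x k
  proof (induction k)
    case 0 show ?case using p by (simp add: computes.prec_0)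
  next
    case (Suc k)
    show ?case
      using computes.prec_Suc[OF Suc q] by simp
  qed
  then have "recursive1 (\<lambda>z. rec_nat (g (pfst z)) (h (pfst z)) (psnd z))"
    unfolding recursive1_def by (metis pr_proj)
  from recursive1_comp[OF this recursive1_pr[OF recursive1_id n]] show ?thesis by simp
qed

lemmas recursive1_basic = recursive1_id recursive1_const recursive1_Suc recursive1_pfst
  recursive1_psnd recursive1_pr

section \<open>Arithmetic, bounded sums and bounded products\<close>

lemma recursive1_add:
  assumes "recursive1 f" "recursive1 g" shows "recursive1 (\<lambda>x. f x + g x)"
proof -
  have "recursive1 (\<lambda>x. rec_nat (f x) (\<lambda>k u. Suc u) (g x))"
    by (intro recursive1_rec recursive1_basic assms)
  moreover have "rec_nat a (\<lambda>k u. Suc u) b = a + b" for a b by (induction b) auto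
  ultimately show ?thesis by simp
qed

lemma recursive1_mult:
  assumes "recursive1 f" "recursive1 g" shows "recursive1 (\<lambda>x. f x * g x)"
proof -
  have "recursive1 (\<lambda>x. rec_nat 0 (\<lambda>k u. u + f x) (g x))"
    by (intro recursive1_rec recursive1_basic recursive1_add recursive1_comp[OF assms(1)] assms)
  moreover have "rec_nat 0 (\<lambda>k u. u + a) b = a * b" for a b :: nat by (induction b) auto
  ultimately show ?thesis by simp
qed

lemma recursive1_diff:
  assumes "recursive1 f" "recursive1 g" shows "recursive1 (\<lambda>x. f x - g x)"
proof -
  \<comment> \<open>A recursion that returns its counter is the predecessor function; iterating it
    gives truncated subtraction.\<close>
  have pred: "recursive1 (\<lambda>x. rec_nat 0 (\<lambda>k u. k) x)"
    by (intro recursive1_rec recursive1_basic)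
  have "recursive1 (\<lambda>x. rec_nat (f x) (\<lambda>k u. rec_nat 0 (\<lambda>k u. k) u) (g x))"
    by (intro recursive1_rec recursive1_basic recursive1_comp[OF pred] assms)
  moreover have "rec_nat a (\<lambda>k u. rec_nat 0 (\<lambda>k u. k) u) b = a - b" for a b :: nat
  proof (induction b)
    case (Suc b)
    moreover have "rec_nat 0 (\<lambda>k u. k) c = c - 1" for c by (cases c) auto
    ultimately show ?case by simp
  qed simp
  ultimately show ?thesis by simp
qed

text \<open>With 0 read as truth, bounded sums and products act as decidable bounded quantifiers: a
  sum vanishes iff all its terms do, a product iff some factor does.\<close>

lemma recursive1_sum:
  assumes h: "recursive1 (\<lambda>z. h (pfst z) (psnd z))" and n: "recursive1 n"
  shows "recursive1 (\<lambda>x. \<Sum>k<n x. h x k :: nat)"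
proof -
  have "recursive1 (\<lambda>x. rec_nat 0 (\<lambda>k u. u + h x k) (n x))"
    using recursive1_comp[OF h, of "\<lambda>z. pr (pfst z) (pfst (psnd z))"]
    by (intro recursive1_rec recursive1_basic recursive1_add n) (simp add: recursive1_basic)
  moreover have "rec_nat 0 (\<lambda>k u. u + h x k) b = (\<Sum>k<b. h x k)" for x b by (induction b) auto
  ultimately show ?thesis by simp
qed

lemma recursive1_prod:
  assumes h: "recursive1 (\<lambda>z. h (pfst z) (psnd z))" and n: "recursive1 n"
  shows "recursive1 (\<lambda>x. \<Prod>k<n x. h x k :: nat)"
proof -
  have "recursive1 (\<lambda>x. rec_nat 1 (\<lambda>k u. u * h x k) (n x))"
    using recursive1_comp[OF h, of "\<lambda>z. pr (pfst z) (pfst (psnd z))"]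
    by (intro recursive1_rec recursive1_basic recursive1_mult n) (simp add: recursive1_basic)
  moreover have "rec_nat 1 (\<lambda>k u. u * h x k) b = (\<Prod>k<b. h x k)" for x b by (induction b) auto
  ultimately show ?thesis by simp
qed

lemmas recursive1_intros = recursive1_basic recursive1_add recursive1_mult recursive1_diff


section \<open>Semirecursive predicates\<close>

text \<open>A projection of a decidable matrix, given by a total \<open>D\<close> for which the
  value 0 means true. With totality, conjunction becomes addition and disjunction becomes
  multiplication.\<close>

definition semirec :: "(nat \<Rightarrow> bool) \<Rightarrow> bool" where
  "semirec P \<longleftrightarrow> (\<exists>D. recursive1 D \<and> (\<forall>x. P x \<longleftrightarrow> (\<exists>k. D (pr x k) = 0)))"

lemma semirecI: "recursive1 D \<Longrightarrow> (\<And>x. P x \<longleftrightarrow> (\<exists>k. D (pr x k) = 0)) \<Longrightarrow> semirec P"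
  unfolding semirec_def by blast

lemma semirec_cong: "semirec P \<Longrightarrow> (\<And>x. Q x \<longleftrightarrow> P x) \<Longrightarrow> semirec Q"
  by presburger

lemma inj_prog_code: "inj prog_code"
proof (rule injI)
  show "prog_code p = prog_code q \<Longrightarrow> p = q" for p q
    by (induction p arbitrary: q; case_tac q) auto
qed

lemma W_prog_code: "W (prog_code p) = {x. \<exists>y. computes p x y}"
  unfolding W_def inj_eq[OF inj_prog_code] by simp

text \<open>Minimisation searches for the witness. As \<open>D\<close> is total, the search reaches
  the least witness whenever there is one. The converse has to wait until computations themselves
  are known to be semirecursive.\<close>

lemma semirec_RE:
  assumes "semirec P" shows "RE {x. P x}"
proof -
  obtain D p where D: "\<And>x. P x \<longleftrightarrow> (\<exists>k. D (pr x k) = 0)" and p: "\<And>x. computes p x (D x)"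
    using assms unfolding semirec_def recursive1_def by metis
  have "P x \<longleftrightarrow> (\<exists>y. computes (Mn p) x y)" for x
  proof
    assume "P x"
    then obtain k where k: "D (pr x k) = 0" "\<And>m. m < k \<Longrightarrow> D (pr x m) \<noteq> 0"
      unfolding D using exists_least_iff[of "\<lambda>k. D (pr x k) = 0"] by auto
    have "computes (Mn p) x k"
      by (rule computes.mn) (metis k p old.nat.exhaust)+
    then show "\<exists>y. computes (Mn p) x y" ..
  next
    assume "\<exists>y. computes (Mn p) x y"
    then obtain y where "computes p (pr x y) 0" by (auto elim: computes_MnE)
    then have "D (pr x y) = 0" using p computes_unique by blast
    then show "P x" unfolding D ..
  qed
  then have "{x. P x} = W (prog_code (Mn p))"
    by (simp add: W_prog_code del: prog_code.simps)
  then show ?thesis unfolding RE_def by blast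
qed

lemma semirec_comp:
  assumes "semirec P" "recursive1 f" shows "semirec (\<lambda>x. P (f x))"
proof -
  obtain D where D: "recursive1 D" "\<And>x. P x \<longleftrightarrow> (\<exists>k. D (pr x k) = 0)"
    using assms(1) unfolding semirec_def by blast
  show ?thesis
    by (rule semirecI[of "\<lambda>z. D (pr (f (pfst z)) (psnd z))"])
      (intro recursive1_comp[OF D(1)] recursive1_comp[OF assms(2)] recursive1_intros, simp add: D(2))
qed

text \<open>Both truncated differences vanish exactly when the values agree; the witness component
  of the argument is ignored.\<close>

lemma semirec_eq:
  assumes "recursive1 f" "recursive1 g" shows "semirec (\<lambda>x. f x = g x)"
  by (rule semirecI[of "\<lambda>z. (f (pfst z) - g (pfst z)) + (g (pfst z) - f (pfst z))"])
    (intro recursive1_comp[OF assms(1)] recursive1_comp[OF assms(2)] recursive1_intros, auto)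

lemma semirec_less:
  assumes "recursive1 f" "recursive1 g" shows "semirec (\<lambda>x. f x < g x)"
  by (rule semirecI[of "\<lambda>z. Suc (f (pfst z)) - g (pfst z)"])
    (intro recursive1_comp[OF assms(1)] recursive1_comp[OF assms(2)] recursive1_intros, auto)

text \<open>The two witnesses are packed into one as a pair, and a sum is 0 iff both summands
  are.\<close>

lemma semirec_conj:
  assumes "semirec P" "semirec Q" shows "semirec (\<lambda>x. P x \<and> Q x)"
proof -
  obtain D where D: "recursive1 D" "\<And>x. P x \<longleftrightarrow> (\<exists>k. D (pr x k) = 0)"
    using assms(1) unfolding semirec_def by blast
  obtain D' where D': "recursive1 D'" "\<And>x. Q x \<longleftrightarrow> (\<exists>k. D' (pr x k) = 0)"
    using assms(2) unfolding semirec_def by blast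
  show ?thesis
    by (rule semirecI[of "\<lambda>z. D (pr (pfst z) (pfst (psnd z))) + D' (pr (pfst z) (psnd (psnd z)))"])
      (intro recursive1_comp[OF D(1)] recursive1_comp[OF D'(1)] recursive1_intros,
        simp add: D(2) D'(2), metis pfst_pr psnd_pr)
qed

lemma semirec_disj:
  assumes "semirec P" "semirec Q" shows "semirec (\<lambda>x. P x \<or> Q x)"
proof -
  obtain D where D: "recursive1 D" "\<And>x. P x \<longleftrightarrow> (\<exists>k. D (pr x k) = 0)"
    using assms(1) unfolding semirec_def by blast
  obtain D' where D': "recursive1 D'" "\<And>x. Q x \<longleftrightarrow> (\<exists>k. D' (pr x k) = 0)"
    using assms(2) unfolding semirec_def by blast
  show ?thesis
    by (rule semirecI[of "\<lambda>z. D z * D' z"])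
      (intro recursive1_mult D(1) D'(1), auto simp add: D(2) D'(2))
qed

lemma semirec_ex:
  assumes "semirec (\<lambda>z. Q (pfst z) (psnd z))" shows "semirec (\<lambda>x. \<exists>y. Q x y)"
proof -
  obtain D where D: "recursive1 D" "\<And>z. Q (pfst z) (psnd z) \<longleftrightarrow> (\<exists>k. D (pr z k) = 0)"
    using assms unfolding semirec_def by blast
  have "Q x y \<longleftrightarrow> (\<exists>k. D (pr (pr x y) k) = 0)" for x y
    using D(2)[of "pr x y"] by simp
  then show ?thesis
    by (intro semirecI[of "\<lambda>z. D (pr (pr (pfst z) (pfst (psnd z))) (psnd (psnd z)))"])
      (intro recursive1_comp[OF D(1)] recursive1_intros, simp, metis pfst_pr psnd_pr)
qed

text \<open>Bounding all the witnesses at once makes the matrix of \<open>\<forall>k < n. \<exists>w\<close> decidable, so no coding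
  of the sequence of witnesses is needed.\<close>

lemma semirec_all_less:
  assumes "semirec (\<lambda>z. Q (pfst z) (psnd z))" and n: "recursive1 n"
  shows "semirec (\<lambda>x. \<forall>k<n x. Q x k)"
proof -
  obtain D where D: "recursive1 D" "\<And>z. Q (pfst z) (psnd z) \<longleftrightarrow> (\<exists>k. D (pr z k) = 0)"
    using assms unfolding semirec_def by blast
  have Q: "Q x y \<longleftrightarrow> (\<exists>k. D (pr (pr x y) k) = 0)" for x y
    using D(2)[of "pr x y"] by simp
  have bound: "(\<forall>k<m. Q x k) \<longleftrightarrow> (\<exists>b. \<forall>k<m. \<exists>w<b. D (pr (pr x k) w) = 0)" for x m
  proof
    assume "\<forall>k<m. Q x k"
    then obtain w where w: "\<And>k. k < m \<Longrightarrow> D (pr (pr x k) (w k)) = 0" unfolding Q by metis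
    \<comment> \<open>The sum of all the witnesses, plus one, is a strict upper bound for each of
      them.\<close>
    have "\<forall>k<m. w k < Suc (\<Sum>k<m. w k)"
      by (auto simp: less_Suc_eq_le intro!: member_le_sum)
    then show "\<exists>b. \<forall>k<m. \<exists>w<b. D (pr (pr x k) w) = 0" using w by meson
  qed (auto simp: Q)
  let ?D = "\<lambda>z. \<Sum>k<n (pfst z). \<Prod>w<psnd z. D (pr (pr (pfst z) k) w)"
  have "recursive1 ?D"
    by (intro recursive1_comp[OF D(1)] recursive1_comp[OF n] recursive1_intros recursive1_sum recursive1_prod)
  moreover have "(\<forall>k<n x. Q x k) \<longleftrightarrow> (\<exists>b. ?D (pr x b) = 0)" for x
    by (auto simp: bound Bex_def)
  ultimately show ?thesis by (rule semirecI)
qed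

section \<open>Access to coded lists\<close>

definition ldrop :: "nat \<Rightarrow> nat \<Rightarrow> nat" where
  "ldrop c i = rec_nat c (\<lambda>_ u. psnd (u - 1)) i"

definition lnth :: "nat \<Rightarrow> nat \<Rightarrow> nat" where
  "lnth c i = pfst (ldrop c i - 1)"

lemma recursive1_ldrop:
  "recursive1 f \<Longrightarrow> recursive1 g \<Longrightarrow> recursive1 (\<lambda>x. ldrop (f x) (g x))"
  unfolding ldrop_def by (intro recursive1_rec recursive1_intros)

lemma recursive1_lnth:
  "recursive1 f \<Longrightarrow> recursive1 g \<Longrightarrow> recursive1 (\<lambda>x. lnth (f x) (g x))"
  unfolding lnth_def by (intro recursive1_ldrop recursive1_intros)

text \<open>A nonempty list is coded by the successor of the pair of its head and the code of its
  tail. At the code 0 of the empty list the formula still works: \<open>0 - 1 = 0\<close> and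
  \<open>psnd 0 = 0\<close>, matching \<open>tl [] = []\<close>.\<close>

lemma list_decode_tl: "list_decode (psnd (c - 1)) = tl (list_decode c)"
proof (cases c)
  case 0
  have "pr 0 0 = 0" by (simp add: prod_encode_def)
  then have "psnd 0 = 0" by (metis psnd_pr)
  then show ?thesis using 0 by simp
next
  case (Suc m) then show ?thesis by (simp add: psnd_def split: prod.split)
qed

lemma list_decode_ldrop: "list_decode (ldrop c i) = drop i (list_decode c)"
proof (induction i)
  case (Suc i)
  then show ?case
    using list_decode_tl[of "ldrop c i"] by (simp add: ldrop_def drop_Suc tl_drop)
qed (simp add: ldrop_def)

lemma list_decode_eq_Nil: "list_decode c = [] \<longleftrightarrow> c = 0"
  by (metis list_decode.simps(1) list_decode_inverse)

lemma ldrop_eq_0: "ldrop c i = 0 \<longleftrightarrow> length (list_decode c) \<le> i"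
  using list_decode_eq_Nil[of "ldrop c i"] by (simp add: list_decode_ldrop)

lemma lnth_eq: "i < length (list_decode c) \<Longrightarrow> lnth c i = list_decode c ! i"
proof -
  assume i: "i < length (list_decode c)"
  then obtain m where m: "ldrop c i = Suc m" using ldrop_eq_0[of c i] not0_implies_Suc by fastforce
  have "hd (list_decode (Suc m)) = pfst m" by (simp add: pfst_def split: prod.split)
  moreover have "list_decode (Suc m) = drop i (list_decode c)"
    using list_decode_ldrop[of c i] m by simp
  ultimately show ?thesis using i by (simp add: lnth_def m hd_drop_conv_nth)
qed

text \<open>The code of a nonempty list exceeds that of its tail. This provides the bound in the sum
  that computes the length.\<close>

lemma length_list_decode_le: "length (list_decode c) \<le> c"
proof (induction c rule: list_decode.induct)
  case (2 n)
  obtain x y where xy: "prod_decode n = (x, y)" by fastforce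
  then have "y \<le> n" by (metis le_prod_encode_2 prod_decode_inverse)
  then show ?case using 2 xy by fastforce
qed simp

text \<open>The length is the number of positions from which something is left of the list;
  \<open>1 - (1 - u)\<close> is the sign of \<open>u\<close>.\<close>

lemma recursive1_length:
  assumes "recursive1 f" shows "recursive1 (\<lambda>x. length (list_decode (f x)))"
proof -
  have "recursive1 (\<lambda>x. \<Sum>i<f x. 1 - (1 - ldrop (f x) i))"
    by (intro recursive1_sum recursive1_ldrop recursive1_intros assms recursive1_comp[OF assms])
  moreover have "(\<Sum>i<c. 1 - (1 - ldrop c i)) = length (list_decode c)" for c
  proof -
    have "(\<Sum>i<c. 1 - (1 - ldrop c i)) = (\<Sum>i<c. if i < length (list_decode c) then 1 else 0)"
    proof (intro sum.cong refl)
      fix i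
      show "1 - (1 - ldrop c i) = (if i < length (list_decode c) then 1 else 0)"
        using ldrop_eq_0[of c i] by (cases "ldrop c i") auto
    qed
    also have "\<dots> = card ({..<c} \<inter> {i. i < length (list_decode c)})"
      by (simp add: sum.If_cases)
    also have "{..<c} \<inter> {i. i < length (list_decode c)} = {..<length (list_decode c)}"
      using length_list_decode_le[of c] by auto
    finally show ?thesis by simp
  qed
  ultimately show ?thesis by simp
qed

lemmas recursive1_list = recursive1_intros recursive1_ldrop recursive1_lnth recursive1_length

lemma semirec_list_all:
  assumes "semirec (\<lambda>z. Q (pfst z) (psnd z))" and c: "recursive1 c"
  shows "semirec (\<lambda>x. \<forall>y\<in>set (list_decode (c x)). Q x y)"
proof -
  have "semirec (\<lambda>x. \<forall>i<length (list_decode (c x)). Q x (lnth (c x) i))"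
    using semirec_comp[OF assms(1), of "\<lambda>z. pr (pfst z) (lnth (c (pfst z)) (psnd z))"]
    by (intro semirec_all_less recursive1_list c)
      (simp add: recursive1_list recursive1_comp[OF c])
  then show ?thesis by (simp add: all_set_conv_all_nth lnth_eq)
qed

lemma semirec_member:
  assumes f: "recursive1 f" and c: "recursive1 c"
  shows "semirec (\<lambda>x. f x \<in> set (list_decode (c x)))"
proof -
  have "semirec (\<lambda>x. \<exists>i. i < length (list_decode (c x)) \<and> f x = lnth (c x) i)"
    by (intro semirec_ex semirec_conj semirec_less semirec_eq recursive1_list
        recursive1_comp[OF c] recursive1_comp[OF f])
  then show ?thesis by (simp add: in_set_conv_nth lnth_eq eq_commute[of "f _"] cong: conj_cong)
qed


section \<open>Enumeration operators and inductive definitions\<close>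

text \<open>Enumeration operators in the sense of enumeration reducibility:
  \<open>E (pr x d)\<close> is a rule with conclusion \<open>x\<close> and the finite list coded by
  \<open>d\<close> as premises. Only finite positive information about \<open>X\<close> is used, so
  such a \<open>J\<close> is monotone.\<close>

definition enum_op :: "((nat \<Rightarrow> bool) \<Rightarrow> nat \<Rightarrow> bool) \<Rightarrow> bool" where
  "enum_op J \<longleftrightarrow> (\<exists>E. semirec E \<and>
    (\<forall>X x. J X x \<longleftrightarrow> (\<exists>d. E (pr x d) \<and> (\<forall>y\<in>set (list_decode d). X y))))"

lemma enum_opI:
  "semirec E \<Longrightarrow> (\<And>X x. J X x \<longleftrightarrow> (\<exists>d. E (pr x d) \<and> (\<forall>y\<in>set (list_decode d). X y))) \<Longrightarrow> enum_op J"
  unfolding enum_op_def by blast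

lemma enum_opE:
  assumes "enum_op J"
  obtains E where "semirec E"
    "\<And>X x. J X x \<longleftrightarrow> (\<exists>d. E (pr x d) \<and> (\<forall>y\<in>set (list_decode d). X y))"
  by (rule exE[OF assms[unfolded enum_op_def]], elim conjE, rule that, assumption) simp

section \<open>Finite derivations and least fixed points\<close>

primrec derivation :: "(nat \<Rightarrow> bool) \<Rightarrow> nat list \<Rightarrow> bool" where
  "derivation E [] \<longleftrightarrow> True"
| "derivation E (x # xs) \<longleftrightarrow>
    (\<exists>d. E (pr x d) \<and> set (list_decode d) \<subseteq> set xs) \<and> derivation E xs"

text \<open>Derivations are listed conclusion first, so the premises of an entry lie behind it.
  Appending therefore only enlarges the supply of premises.\<close>

lemma derivation_append:
  "derivation E xs \<Longrightarrow> derivation E ys \<Longrightarrow> derivation E (xs @ ys)"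
  by (induction xs) auto

text \<open>A form without recursion, which can be transcribed to codes by \<open>lnth\<close>,
  \<open>ldrop\<close> and bounded quantifiers.\<close>

lemma derivation_nth:
  "derivation E xs \<longleftrightarrow>
    (\<forall>i<length xs. \<exists>d. E (pr (xs ! i) d) \<and> set (list_decode d) \<subseteq> set (drop (Suc i) xs))"
proof (induction xs)
  case (Cons a xs)
  show ?case by (simp add: Cons All_less_Suc2)
qed simp

lemma derivation_collect:
  "(\<And>y. y \<in> set ys \<Longrightarrow> \<exists>xs. derivation E xs \<and> y \<in> set xs) \<Longrightarrow>
    \<exists>xs. derivation E xs \<and> set ys \<subseteq> set xs"
proof (induction ys)
  case Nil show ?case by (rule exI[of _ "[]"]) simp
next
  case (Cons y ys)
  obtain xs where xs: "derivation E xs" "set ys \<subseteq> set xs" using Cons by auto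
  obtain zs where zs: "derivation E zs" "y \<in> set zs" using Cons.prems[of y] by auto
  show ?case using derivation_append[OF xs(1) zs(1)] xs(2) zs(2)
    by (intro exI[of _ "xs @ zs"]) auto
qed

text \<open>The assumptions \<open>closed\<close> and \<open>least\<close> say that \<open>S\<close>
  is the least set closed under \<open>J\<close>. Its elements are exactly the entries of
  derivations, and being a derivation is semirecursive on codes. Below, \<open>J\<close> is always a
  disjunction with one disjunct per rule of an inductive notion.\<close>

theorem semirec_least:
  assumes J: "enum_op J"
    and closed: "\<And>x. J S x \<Longrightarrow> S x"
    and least: "\<And>P x. (\<And>x. J P x \<Longrightarrow> P x) \<Longrightarrow> S x \<Longrightarrow> P x"
  shows "semirec S"
proof -
  obtain E where E: "semirec E"
    "\<And>X x. J X x \<longleftrightarrow> (\<exists>d. E (pr x d) \<and> (\<forall>y\<in>set (list_decode d). X y))"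
    using J by (rule enum_opE) blast
  have sound: "derivation E xs \<Longrightarrow> \<forall>x\<in>set xs. S x" for xs
    by (induction xs) (auto intro!: closed simp: E(2), blast)
  have complete: "\<exists>xs. derivation E xs \<and> x \<in> set xs" if "S x" for x
  \<comment> \<open>Minimality is applied to the set of derivable numbers: derivations of the
    finitely many premises are joined into one, and \<open>x\<close> is put in front.\<close>
  proof (rule least[OF _ that])
    fix x assume "J (\<lambda>x. \<exists>xs. derivation E xs \<and> x \<in> set xs) x"
    then obtain d where d: "E (pr x d)"
      "\<And>y. y \<in> set (list_decode d) \<Longrightarrow> \<exists>xs. derivation E xs \<and> y \<in> set xs"
      unfolding E(2) by blast
    obtain xs where "derivation E xs" "set (list_decode d) \<subseteq> set xs"
      using derivation_collect[OF d(2)] by blast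
    then show "\<exists>xs. derivation E xs \<and> x \<in> set xs"
      using d(1) by (intro exI[of _ "x # xs"]) auto
  qed
  \<comment> \<open>\<open>derivation\<close>, spelled out on the code \<open>c\<close> of the
    list.\<close>
  let ?V = "\<lambda>c. \<forall>i<length (list_decode c). \<exists>d. E (pr (lnth c i) d) \<and>
      (\<forall>y\<in>set (list_decode d). y \<in> set (list_decode (ldrop c (Suc i))))"
  have V: "?V c \<longleftrightarrow> derivation E (list_decode c)" for c
    by (simp add: derivation_nth lnth_eq list_decode_ldrop subset_eq)
  have "semirec (\<lambda>x. \<exists>c. ?V c \<and> x \<in> set (list_decode c))"
    by (intro semirec_ex semirec_conj semirec_all_less semirec_list_all semirec_member
        semirec_comp[OF E(1)] recursive1_list)
  moreover have "S x \<longleftrightarrow> (\<exists>c. ?V c \<and> x \<in> set (list_decode c))" for x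
    unfolding V using sound complete by (metis list_encode_inverse)
  ultimately show ?thesis by (rule semirec_cong)
qed

section \<open>Closure properties of enumeration operators\<close>

lemma enum_op_semirec:
  assumes "semirec P" "recursive1 f" shows "enum_op (\<lambda>X x. P (f x))"
\<comment> \<open>A side condition independent of \<open>X\<close> is a rule without premises; 0 is
  the code of the empty list.\<close>
proof (rule enum_opI[of "\<lambda>z. P (f (pfst z)) \<and> psnd z = 0"])
  show "semirec (\<lambda>z. P (f (pfst z)) \<and> psnd z = 0)"
    by (intro semirec_conj semirec_comp[OF assms(1)] recursive1_comp[OF assms(2)] semirec_eq
        recursive1_intros)
qed auto

lemma enum_op_eq: "recursive1 f \<Longrightarrow> recursive1 g \<Longrightarrow> enum_op (\<lambda>X x. f x = g x)"
  by (rule enum_op_semirec[OF semirec_eq recursive1_id])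

lemma enum_op_less: "recursive1 f \<Longrightarrow> recursive1 g \<Longrightarrow> enum_op (\<lambda>X x. f x < g x)"
  by (rule enum_op_semirec[OF semirec_less recursive1_id])

text \<open>Any premise list containing \<open>f x\<close> is accepted; the singleton list shows
  that one is available when \<open>X (f x)\<close> holds.\<close>

lemma enum_op_arg:
  assumes f: "recursive1 f" shows "enum_op (\<lambda>X x. X (f x))"
proof (rule enum_opI[of "\<lambda>z. f (pfst z) \<in> set (list_decode (psnd z))"])
  show "semirec (\<lambda>z. f (pfst z) \<in> set (list_decode (psnd z)))"
    by (intro semirec_member recursive1_comp[OF f] recursive1_intros)
  have "f x \<in> set (list_decode (list_encode [f x]))" for x by (simp del: list_encode.simps)
  moreover have "\<forall>y\<in>set (list_decode (list_encode [f x])). y = f x" for x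
    by (simp del: list_encode.simps)
  ultimately show "X (f x) \<longleftrightarrow>
      (\<exists>d. f (pfst (pr x d)) \<in> set (list_decode (psnd (pr x d))) \<and> (\<forall>y\<in>set (list_decode d). X y))"
    for X x by (metis pfst_pr psnd_pr)
qed

text \<open>\<open>?E\<close> asks only that \<open>d\<close> contain both premise lists, so
  concatenation of codes need not be shown recursive; it occurs only as a witness.\<close>

lemma enum_op_conj:
  assumes "enum_op A" "enum_op B" shows "enum_op (\<lambda>X x. A X x \<and> B X x)"
proof -
  obtain E where E: "semirec E"
    "\<And>X x. A X x \<longleftrightarrow> (\<exists>d. E (pr x d) \<and> (\<forall>y\<in>set (list_decode d). X y))"
    using assms(1) by (rule enum_opE) blast
  obtain F where F: "semirec F"
    "\<And>X x. B X x \<longleftrightarrow> (\<exists>d. F (pr x d) \<and> (\<forall>y\<in>set (list_decode d). X y))"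
    using assms(2) by (rule enum_opE) blast
  let ?E = "\<lambda>z. \<exists>c. \<exists>d. E (pr (pfst z) c) \<and> F (pr (pfst z) d) \<and>
    (\<forall>y\<in>set (list_decode c). y \<in> set (list_decode (psnd z))) \<and>
    (\<forall>y\<in>set (list_decode d). y \<in> set (list_decode (psnd z)))"
  show ?thesis
  proof (rule enum_opI)
    show "semirec ?E"
      by (intro semirec_ex semirec_conj semirec_list_all semirec_member
        semirec_comp[OF E(1)] semirec_comp[OF F(1)] recursive1_list)
    show "A X x \<and> B X x \<longleftrightarrow> (\<exists>d. ?E (pr x d) \<and> (\<forall>y\<in>set (list_decode d). X y))" for X x
    proof
      assume "A X x \<and> B X x"
      then obtain c d where "E (pr x c)" "\<forall>y\<in>set (list_decode c). X y"
        "F (pr x d)" "\<forall>y\<in>set (list_decode d). X y" unfolding E(2) F(2) by blast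
      then show "\<exists>d. ?E (pr x d) \<and> (\<forall>y\<in>set (list_decode d). X y)"
        by (intro exI[of _ "list_encode (list_decode c @ list_decode d)"]) auto
    qed (auto simp: E(2) F(2))
  qed
qed

lemma enum_op_disj:
  assumes "enum_op A" "enum_op B" shows "enum_op (\<lambda>X x. A X x \<or> B X x)"
proof -
  obtain E where E: "semirec E"
    "\<And>X x. A X x \<longleftrightarrow> (\<exists>d. E (pr x d) \<and> (\<forall>y\<in>set (list_decode d). X y))"
    using assms(1) by (rule enum_opE) blast
  obtain F where F: "semirec F"
    "\<And>X x. B X x \<longleftrightarrow> (\<exists>d. F (pr x d) \<and> (\<forall>y\<in>set (list_decode d). X y))"
    using assms(2) by (rule enum_opE) blast
  show ?thesis
    by (rule enum_opI[OF semirec_disj[OF E(1) F(1)]]) (auto simp: E(2) F(2))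
qed

lemma enum_op_ex:
  assumes "enum_op (\<lambda>X z. A X (pfst z) (psnd z))" shows "enum_op (\<lambda>X x. \<exists>y. A X x y)"
proof -
  obtain E where E: "semirec E"
    "\<And>X z. A X (pfst z) (psnd z) \<longleftrightarrow> (\<exists>d. E (pr z d) \<and> (\<forall>y\<in>set (list_decode d). X y))"
    using assms by (rule enum_opE) blast
  have A: "A X x y \<longleftrightarrow> (\<exists>d. E (pr (pr x y) d) \<and> (\<forall>y\<in>set (list_decode d). X y))" for X x y
    using E(2)[of X "pr x y"] by simp
  show ?thesis
  proof (rule enum_opI)
    show "semirec (\<lambda>z. \<exists>y. E (pr (pr (pfst z) y) (psnd z)))"
      by (intro semirec_ex semirec_comp[OF E(1)] recursive1_intros)
  qed (auto simp: A)
qed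

text \<open>One premise list is chosen for each \<open>k\<close>, and the finitely many lists are
  concatenated; again \<open>?E\<close> asks only for containment.\<close>

lemma enum_op_all_less:
  assumes "enum_op (\<lambda>X z. A X (pfst z) (psnd z))" and n: "recursive1 n"
  shows "enum_op (\<lambda>X x. \<forall>k<n x. A X x k)"
proof -
  obtain E where E: "semirec E"
    "\<And>X z. A X (pfst z) (psnd z) \<longleftrightarrow> (\<exists>d. E (pr z d) \<and> (\<forall>y\<in>set (list_decode d). X y))"
    using assms(1) by (rule enum_opE) blast
  have A: "A X x y \<longleftrightarrow> (\<exists>d. E (pr (pr x y) d) \<and> (\<forall>y\<in>set (list_decode d). X y))" for X x y
    using E(2)[of X "pr x y"] by simp
  let ?E = "\<lambda>z. \<forall>k<n (pfst z). \<exists>d. E (pr (pr (pfst z) k) d) \<and>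
    (\<forall>y\<in>set (list_decode d). y \<in> set (list_decode (psnd z)))"
  show ?thesis
  proof (rule enum_opI)
    show "semirec ?E"
      by (intro semirec_ex semirec_conj semirec_list_all semirec_member semirec_all_less
        semirec_comp[OF E(1)] recursive1_list recursive1_comp[OF n])
    show "(\<forall>k<n x. A X x k) \<longleftrightarrow> (\<exists>d. ?E (pr x d) \<and> (\<forall>y\<in>set (list_decode d). X y))" for X x
    proof
      assume "\<forall>k<n x. A X x k"
      then obtain d where "\<And>k. k < n x \<Longrightarrow> E (pr (pr x k) (d k)) \<and> (\<forall>y\<in>set (list_decode (d k)). X y)"
        unfolding A by metis
      then show "\<exists>d. ?E (pr x d) \<and> (\<forall>y\<in>set (list_decode d). X y)"
        by (intro exI[of _ "list_encode (concat (map (\<lambda>k. list_decode (d k)) [0..<n x]))"]) fastforce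
    qed (auto simp: A, meson)
  qed
qed

lemma enum_op_comp:
  assumes "enum_op A" "recursive1 f" shows "enum_op (\<lambda>X x. A X (f x))"
proof -
  obtain E where E: "semirec E"
    "\<And>X x. A X x \<longleftrightarrow> (\<exists>d. E (pr x d) \<and> (\<forall>y\<in>set (list_decode d). X y))"
    using assms(1) by (rule enum_opE) blast
  show ?thesis
  proof (rule enum_opI)
    show "semirec (\<lambda>z. E (pr (f (pfst z)) (psnd z)))"
      by (intro semirec_comp[OF E(1)] recursive1_comp[OF assms(2)] recursive1_intros)
  qed (auto simp: E(2))
qed

text \<open>Reduces to a bounded quantifier over positions. It serves the argument lists of function
  and relation symbols.\<close>

lemma enum_op_list_all2:
  assumes A: "enum_op (\<lambda>X z. A X (pfst z) (pfst (psnd z)) (psnd (psnd z)))"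
    and f: "recursive1 f" and g: "recursive1 g"
  shows "enum_op (\<lambda>X x. list_all2 (\<lambda>a b. A X x a b) (list_decode (f x)) (list_decode (g x)))"
proof -
  have "enum_op (\<lambda>X z. A X (pfst z) (lnth (f (pfst z)) (psnd z)) (lnth (g (pfst z)) (psnd z)))"
    using enum_op_comp[OF A, of
        "\<lambda>z. pr (pfst z) (pr (lnth (f (pfst z)) (psnd z)) (lnth (g (pfst z)) (psnd z)))"]
    by (simp add: recursive1_list recursive1_comp[OF f] recursive1_comp[OF g])
  then have "enum_op (\<lambda>X x. length (list_decode (f x)) = length (list_decode (g x)) \<and>
      (\<forall>i<length (list_decode (f x)). A X x (lnth (f x) i) (lnth (g x) i)))"
    by (intro enum_op_conj enum_op_eq enum_op_all_less recursive1_list f g)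
  then show ?thesis by (simp add: list_all2_conv_all_nth lnth_eq cong: conj_cong)
qed

lemma enum_op_list_all:
  assumes A: "enum_op (\<lambda>X z. A X (pfst z) (psnd z))" and f: "recursive1 f"
  shows "enum_op (\<lambda>X x. \<forall>y\<in>set (list_decode (f x)). A X x y)"
proof -
  have "enum_op (\<lambda>X z. A X (pfst z) (lnth (f (pfst z)) (psnd z)))"
    using enum_op_comp[OF A, of "\<lambda>z. pr (pfst z) (lnth (f (pfst z)) (psnd z))"]
    by (simp add: recursive1_list recursive1_comp[OF f])
  then have "enum_op (\<lambda>X x. \<forall>i<length (list_decode (f x)). A X x (lnth (f x) i))"
    by (intro enum_op_all_less recursive1_list f)
  then show ?thesis by (simp add: all_set_conv_all_nth lnth_eq)
qed

lemmas enum_op_intros = enum_op_eq enum_op_less enum_op_arg enum_op_conj enum_op_disj enum_op_ex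
  enum_op_all_less enum_op_list_all enum_op_list_all2 recursive1_list

section \<open>Universality of the enumeration of RE sets\<close>

text \<open>Needed for computations because the base case of \<open>Prec\<close> never runs the step
  program: that the latter has a genuine code must be required separately.\<close>

lemma semirec_prog_code: "semirec (\<lambda>z. z \<in> range prog_code)"
proof (rule semirec_least)
  let ?J = "\<lambda>X z. z = pr 0 0 \<or> z = pr 1 0 \<or> z = pr 2 0 \<or> z = pr 3 0 \<or>
    (\<exists>a. \<exists>b. X a \<and> X b \<and> z = pr 4 (pr a b)) \<or> (\<exists>a. \<exists>b. X a \<and> X b \<and> z = pr 5 (pr a b)) \<or>
    (\<exists>a. \<exists>b. X a \<and> X b \<and> z = pr 6 (pr a b)) \<or> (\<exists>a. X a \<and> z = pr 7 a)"
  show "enum_op ?J" by (intro enum_op_intros)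
  show "?J (\<lambda>z. z \<in> range prog_code) z \<Longrightarrow> z \<in> range prog_code" for z
    by (auto simp del: prog_code.simps One_nat_def simp add: prog_code.simps[symmetric])
  show "P z" if P: "\<And>z. ?J P z \<Longrightarrow> P z" and "z \<in> range prog_code" for P z
  proof -
    have "P (prog_code p)" for p by (induction p) (auto intro: P)
    then show ?thesis using \<open>z \<in> range prog_code\<close> by blast
  qed
qed

definition computes_code :: "nat \<Rightarrow> bool" where
  "computes_code z \<longleftrightarrow> (\<exists>p x y. z = pr (prog_code p) (pr x y) \<and> computes p x y)"

lemma computes_code_iff: "computes_code (pr (prog_code p) (pr x y)) \<longleftrightarrow> computes p x y"
  by (auto simp: computes_code_def inj_eq[OF inj_prog_code])

lemma computes_codeE:
  assumes "computes_code (pr a (pr x y))"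
  obtains p where "a = prog_code p" "computes p x y"
  using assms by (auto simp: computes_code_def)

text \<open>The disjuncts of \<open>?J\<close> are the rules of \<open>computes\<close> in order.
  The rule for \<open>Mn\<close> fits since its condition on smaller arguments is a bounded
  quantifier with positive matrix.\<close>

lemma semirec_computes_code: "semirec computes_code"
proof (rule semirec_least)
  let ?J = "\<lambda>X z. (\<exists>x. z = pr (pr 0 0) (pr x 0)) \<or> (\<exists>x. z = pr (pr 1 0) (pr x (Suc x))) \<or>
    (\<exists>x. \<exists>y. z = pr (pr 2 0) (pr (pr x y) x)) \<or> (\<exists>x. \<exists>y. z = pr (pr 3 0) (pr (pr x y) y)) \<or>
    (\<exists>a. \<exists>b. \<exists>x. \<exists>u. \<exists>v. X (pr a (pr x u)) \<and> X (pr b (pr x v)) \<and>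
      z = pr (pr 4 (pr a b)) (pr x (pr u v))) \<or>
    (\<exists>a. \<exists>b. \<exists>x. \<exists>u. \<exists>v. X (pr b (pr x u)) \<and> X (pr a (pr u v)) \<and>
      z = pr (pr 5 (pr a b)) (pr x v)) \<or>
    (\<exists>a. \<exists>b. \<exists>x. \<exists>v. X (pr a (pr x v)) \<and> b \<in> range prog_code \<and>
      z = pr (pr 6 (pr a b)) (pr (pr x 0) v)) \<or>
    (\<exists>a. \<exists>b. \<exists>x. \<exists>k. \<exists>u. \<exists>v. X (pr (pr 6 (pr a b)) (pr (pr x k) u)) \<and>
      X (pr b (pr (pr x (pr k u)) v)) \<and> z = pr (pr 6 (pr a b)) (pr (pr x (Suc k)) v)) \<or>
    (\<exists>a. \<exists>x. \<exists>k. X (pr a (pr (pr x k) 0)) \<and> (\<forall>m<k. \<exists>v. X (pr a (pr (pr x m) (Suc v)))) \<and>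
      z = pr (pr 7 a) (pr x k))"
  show "enum_op ?J" by (intro enum_op_intros enum_op_semirec[OF semirec_prog_code])
  show "computes_code z" if "?J computes_code z" for z
    using that
  proof (elim disjE exE conjE)
    fix x assume "z = pr (pr 0 0) (pr x 0)"
    then show ?thesis using computes_code_iff[of Zero] computes.zero by simp
  next
    fix x assume "z = pr (pr 1 0) (pr x (Suc x))"
    then show ?thesis using computes_code_iff[of Succ] computes.succ by simp
  next
    fix x y assume "z = pr (pr 2 0) (pr (pr x y) x)"
    then show ?thesis using computes_code_iff[of Fst] computes.fst by simp
  next
    fix x y assume "z = pr (pr 3 0) (pr (pr x y) y)"
    then show ?thesis using computes_code_iff[of Snd] computes.snd by simp
  next
    fix a b x u v assume *: "computes_code (pr a (pr x u))" "computes_code (pr b (pr x v))"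
      "z = pr (pr 4 (pr a b)) (pr x (pr u v))"
    obtain p q where "a = prog_code p" "computes p x u" "b = prog_code q" "computes q x v"
      using *(1,2) by (metis computes_codeE)
    then show ?thesis using computes_code_iff[of "Pair p q"] computes.pair *(3) by simp
  next
    fix a b x u v assume *: "computes_code (pr b (pr x u))" "computes_code (pr a (pr u v))"
      "z = pr (pr 5 (pr a b)) (pr x v)"
    obtain p q where "a = prog_code p" "computes p u v" "b = prog_code q" "computes q x u"
      using *(1,2) by (metis computes_codeE)
    then show ?thesis using computes_code_iff[of "Comp p q" x v] computes.comp *(3) by simp
  next
    fix a b x v assume *: "computes_code (pr a (pr x v))" "b \<in> range prog_code"
      "z = pr (pr 6 (pr a b)) (pr (pr x 0) v)"
    obtain p q where "a = prog_code p" "computes p x v" "b = prog_code q"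
      using *(1,2) by (metis computes_codeE imageE)
    then show ?thesis using computes_code_iff[of "Prec p q"] computes.prec_0 *(3) by simp
  next
    fix a b x k u v assume *: "computes_code (pr (pr 6 (pr a b)) (pr (pr x k) u))"
      "computes_code (pr b (pr (pr x (pr k u)) v))" "z = pr (pr 6 (pr a b)) (pr (pr x (Suc k)) v)"
    obtain r q where r: "pr 6 (pr a b) = prog_code r" "computes r (pr x k) u"
      "b = prog_code q" "computes q (pr x (pr k u)) v"
      using *(1,2) by (metis computes_codeE)
    \<comment> \<open>The tag 6 forces \<open>r\<close> to be a \<open>Prec\<close>, and injectivity
      of the coding identifies its step program with \<open>q\<close>.\<close>
    obtain p where "r = Prec p q"
      using r(1,3) by (cases r) (auto simp: inj_eq[OF inj_prog_code])
    then have "computes r (pr x (Suc k)) v" using r computes.prec_Suc by blast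
    then show ?thesis using computes_code_iff[of r] r(1) *(3) by simp
  next
    fix a x k assume *: "computes_code (pr a (pr (pr x k) 0))"
      "\<forall>m<k. \<exists>v. computes_code (pr a (pr (pr x m) (Suc v)))" "z = pr (pr 7 a) (pr x k)"
    obtain p where p: "a = prog_code p" "computes p (pr x k) 0" using *(1) by (metis computes_codeE)
    then have "\<forall>m<k. \<exists>v. computes p (pr x m) (Suc v)" using *(2) by (simp add: computes_code_iff)
    then have "computes (Mn p) x k" using p(2) by (intro computes.mn)
    then show ?thesis using computes_code_iff[of "Mn p"] *(3) p(1) by simp
  qed
  show "P z" if P: "\<And>z. ?J P z \<Longrightarrow> P z" and z: "computes_code z" for P z
  proof -
    have "P (pr (prog_code p) (pr x y))" if "computes p x y" for p x y
      using that
    proof (induction rule: computes.induct)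
      case (prec_0 p x v q)
      then show ?case by (intro P) auto
    next
      case (prec_Suc p q x k u v)
      then show ?case by (intro P) auto
    next
      case (mn p x k)
      then show ?case by (intro P) auto
    qed (auto intro: P)
    then show ?thesis using z unfolding computes_code_def by blast
  qed
qed

text \<open>Uniformity in the index is the content. A number that codes no program satisfies neither
  side, in agreement with its indexing the empty set.\<close>

theorem semirec_W: "semirec (\<lambda>z. psnd z \<in> W (pfst z))"
proof -
  have "semirec (\<lambda>z. \<exists>y. computes_code (pr (pfst z) (pr (psnd z) y)))"
    by (intro semirec_ex semirec_comp[OF semirec_computes_code] recursive1_intros)
  moreover have "(\<exists>y. computes_code (pr i (pr x y))) \<longleftrightarrow> x \<in> W i" for i x
    by (auto simp: computes_code_def W_def)
  ultimately show ?thesis by simp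
qed

corollary RE_iff_semirec: "RE A \<longleftrightarrow> semirec (\<lambda>x. x \<in> A)"
proof
  assume "RE A"
  then obtain i where "A = W i" unfolding RE_def ..
  then show "semirec (\<lambda>x. x \<in> A)"
    using semirec_comp[OF semirec_W, of "\<lambda>x. pr i x"] by (simp add: recursive1_basic)
qed (use semirec_RE[of "\<lambda>x. x \<in> A"] in simp)

lemma semirec_recursive_set: "recursive_set A \<Longrightarrow> semirec (\<lambda>x. x \<in> A)"
proof -
  assume "recursive_set A"
  then have "recursive1 (\<lambda>x. if x \<in> A then 1 else 0)"
    unfolding recursive_set_def recursive1_def .
  from semirec_eq[OF this recursive1_const[of 1]] show ?thesis by (simp split: if_splits)
qed


section \<open>The syntax on codes\<close>

lemma inj_gn_tm: "inj gn_tm"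
proof (rule injI)
  show "gn_tm s = gn_tm t \<Longrightarrow> s = t" for s t
  proof (induction s arbitrary: t)
    case (Var i) then show ?case by (cases t) auto
  next
    case (Fun f ss)
    then obtain ts where t: "t = Fun f ts" "map gn_tm ss = map gn_tm ts"
      by (cases t) (auto simp: list_encode_eq)
    have "ss = ts"
      using t(2) Fun.IH by (metis (no_types, lifting) list.inj_map_strong)
    then show ?case using t by simp
  qed
qed

lemma inj_gn: "inj gn"
proof (rule injI)
  show "gn \<phi> = gn \<psi> \<Longrightarrow> \<phi> = \<psi>" for \<phi> \<psi>
    by (induction \<phi> arbitrary: \<psi>; case_tac \<psi>)
      (auto simp: list_encode_eq inj_eq[OF inj_gn_tm] inj_eq[OF inj_mapI[OF inj_gn_tm]])
qed

text \<open>The terms that exist at each position are assembled into one list, which turns the codes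
  of two argument lists back into syntax.\<close>

lemma list_all2_gn_tm:
  "list_all2 (\<lambda>a b. \<exists>t. a = gn_tm t \<and> b = gn_tm (g t)) xs ys \<longleftrightarrow>
    (\<exists>ts. xs = map gn_tm ts \<and> ys = map gn_tm (map g ts))"
proof
  show "list_all2 (\<lambda>a b. \<exists>t. a = gn_tm t \<and> b = gn_tm (g t)) xs ys \<Longrightarrow>
    \<exists>ts. xs = map gn_tm ts \<and> ys = map gn_tm (map g ts)"
  proof (induction rule: list_all2_induct)
    case Nil show ?case by simp
  next
    case (Cons x xs y ys)
    then obtain t ts where "x # xs = map gn_tm (t # ts)" "y # ys = map gn_tm (map g (t # ts))" by auto
    then show ?case by (intro exI[of _ "t # ts"] conjI)
  qed
qed (auto simp: list_all2_conv_all_nth)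

text \<open>A term operation that recurses through function symbols, with a parameter \<open>q\<close>; the instances
  are lifting and substitution, where \<open>q\<close> is the level resp. the level and the substituted term.\<close>

lemma semirec_tm_op:
  fixes enc :: "'q \<Rightarrow> nat"
  assumes enc: "inj enc"
    and var: "semirec (\<lambda>z. \<exists>q i. z = pr (enc q) (pr i (gn_tm (F q (Var i)))))"
    and F_Fun: "\<And>q f ts. F q (Fun f ts) = Fun f (map (F q) ts)"
  shows "semirec (\<lambda>z. \<exists>q t. z = pr (enc q) (pr (gn_tm t) (gn_tm (F q t))))"
    (is "semirec ?S")
proof (rule semirec_least)
  let ?V = "\<lambda>z. \<exists>q i. z = pr (enc q) (pr i (gn_tm (F q (Var i))))"
  \<comment> \<open>For an empty argument list the pointwise condition says nothing about
    \<open>a\<close>; \<open>?R\<close> ensures that \<open>a\<close> still codes a parameter. It is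
    a projection of the graph on variables.\<close>
  let ?R = "\<lambda>z. \<exists>q. z = enc q"
  have R: "semirec ?R"
  proof -
    have "semirec (\<lambda>x. \<exists>b. ?V (pr x (pr 0 b)))"
      by (intro semirec_ex semirec_comp[OF var] recursive1_intros)
    moreover have "(\<exists>b. ?V (pr x (pr 0 b))) \<longleftrightarrow> ?R x" for x by auto
    ultimately show ?thesis by simp
  qed
  let ?J = "\<lambda>X z. (\<exists>a. \<exists>i. \<exists>b. ?V (pr a (pr i b)) \<and> z = pr a (pr (pr 0 i) b)) \<or>
    (\<exists>a. \<exists>f. \<exists>c. \<exists>d. ?R a \<and>
      list_all2 (\<lambda>x y. X (pr a (pr x y))) (list_decode c) (list_decode d) \<and>
      z = pr a (pr (pr 1 (pr f c)) (pr 1 (pr f d))))"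
  show "enum_op ?J"
    by (intro enum_op_disj enum_op_ex enum_op_conj enum_op_list_all2 enum_op_arg enum_op_eq
      recursive1_list enum_op_semirec[OF var] enum_op_semirec[OF R])
  show "?S z" if "?J ?S z" for z
    using that
  proof (elim disjE exE conjE)
    fix a i b q j assume "z = pr a (pr (pr 0 i) b)" "pr a (pr i b) = pr (enc q) (pr j (gn_tm (F q (Var j))))"
    then show "?S z" by (auto intro!: exI[of _ q] exI[of _ "Var i"])
  next
    fix a f c d q
    assume z: "z = pr a (pr (pr 1 (pr f c)) (pr 1 (pr f d)))" and a: "a = enc q"
      and l: "list_all2 (\<lambda>x y. ?S (pr a (pr x y))) (list_decode c) (list_decode d)"
    have "list_all2 (\<lambda>x y. \<exists>t. x = gn_tm t \<and> y = gn_tm (F q t)) (list_decode c) (list_decode d)"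
      using l by (simp add: a inj_eq[OF enc] cong: list.rel_cong)
    then obtain ts where "list_decode c = map gn_tm ts" "list_decode d = map gn_tm (map (F q) ts)"
      unfolding list_all2_gn_tm by blast
    then have "c = list_encode (map gn_tm ts)" "d = list_encode (map gn_tm (map (F q) ts))"
      by (metis list_decode_inverse)+
    then have "z = pr (enc q) (pr (gn_tm (Fun f ts)) (gn_tm (F q (Fun f ts))))"
      by (simp add: z a F_Fun)
    then show "?S z" by blast
  qed
  show "P z" if P: "\<And>z. ?J P z \<Longrightarrow> P z" and z: "?S z" for P z
  proof -
    have "P (pr (enc q) (pr (gn_tm t) (gn_tm (F q t))))" for q t
    proof (induction t)
      case (Var i) show ?case by (intro P) auto
    next
      case (Fun f ts)
      show ?case
        by (intro P disjI2 exI[of _ "enc q"] exI[of _ f] exI[of _ "list_encode (map gn_tm ts)"]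
          exI[of _ "list_encode (map gn_tm (map (F q) ts))"])
          (use Fun in \<open>auto simp: F_Fun list_all2_conv_all_nth\<close>)
    qed
    then show ?thesis using z by blast
  qed
qed

text \<open>The analogue for formulas, where \<open>next\<close> is the change of the parameter
  under a quantifier.\<close>

lemma semirec_fm_op:
  fixes enc :: "'q \<Rightarrow> nat"
  assumes enc: "inj enc"
    and tm: "semirec (\<lambda>z. \<exists>q t. z = pr (enc q) (pr (gn_tm t) (gn_tm (F q t))))"
    and step: "semirec (\<lambda>z. \<exists>q. z = pr (enc q) (enc (next q)))"
    and G: "\<And>q. G q Bot = Bot" "\<And>q s t. G q (Eq s t) = Eq (F q s) (F q t)"
      "\<And>q r ts. G q (Rel r ts) = Rel r (map (F q) ts)"
      "\<And>q \<phi> \<psi>. G q (Imp \<phi> \<psi>) = Imp (G q \<phi>) (G q \<psi>)" "\<And>q \<phi>. G q (All \<phi>) = All (G (next q) \<phi>)"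
  shows "semirec (\<lambda>z. \<exists>q \<phi>. z = pr (enc q) (pr (gn \<phi>) (gn (G q \<phi>))))"
    (is "semirec ?S")
proof (rule semirec_least)
  let ?T = "\<lambda>z. \<exists>q t. z = pr (enc q) (pr (gn_tm t) (gn_tm (F q t)))"
  let ?N = "\<lambda>z. \<exists>q. z = pr (enc q) (enc (next q))"
  \<comment> \<open>In the clauses for \<open>Bot\<close> and \<open>Rel\<close>, the condition
    \<open>?N (pr a b)\<close> only guarantees that \<open>a\<close> codes a parameter.\<close>
  let ?J = "\<lambda>X z. (\<exists>a. \<exists>b. ?N (pr a b) \<and> z = pr a (pr (pr 0 0) (pr 0 0))) \<or>
    (\<exists>a. \<exists>s. \<exists>s'. \<exists>t. \<exists>t'. ?T (pr a (pr s s')) \<and> ?T (pr a (pr t t')) \<and>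
      z = pr a (pr (pr 1 (pr s t)) (pr 1 (pr s' t')))) \<or>
    (\<exists>a. \<exists>r. \<exists>c. \<exists>d. \<exists>b. ?N (pr a b) \<and>
      list_all2 (\<lambda>x y. ?T (pr a (pr x y))) (list_decode c) (list_decode d) \<and>
      z = pr a (pr (pr 2 (pr r c)) (pr 2 (pr r d)))) \<or>
    (\<exists>a. \<exists>s. \<exists>s'. \<exists>t. \<exists>t'. X (pr a (pr s s')) \<and> X (pr a (pr t t')) \<and>
      z = pr a (pr (pr 3 (pr s t)) (pr 3 (pr s' t')))) \<or>
    (\<exists>a. \<exists>b. \<exists>s. \<exists>s'. ?N (pr a b) \<and> X (pr b (pr s s')) \<and> z = pr a (pr (pr 4 s) (pr 4 s')))"
  show "enum_op ?J"
    by (intro enum_op_disj enum_op_ex enum_op_conj enum_op_list_all2 enum_op_arg enum_op_eq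
      recursive1_list enum_op_semirec[OF tm] enum_op_semirec[OF step])
  show "?S z" if "?J ?S z" for z
    using that
  proof (elim disjE)
    assume "\<exists>a b. ?N (pr a b) \<and> z = pr a (pr (pr 0 0) (pr 0 0))"
    then obtain q where "z = pr (enc q) (pr (gn Bot) (gn (G q Bot)))" by (auto simp: G)
    then show "?S z" by blast
  next
    assume "\<exists>a s s' t t'. ?T (pr a (pr s s')) \<and> ?T (pr a (pr t t')) \<and>
      z = pr a (pr (pr 1 (pr s t)) (pr 1 (pr s' t')))"
    then obtain q s t where "z = pr (enc q) (pr (gn (Eq s t)) (gn (G q (Eq s t))))"
      by (auto simp: G inj_eq[OF enc])
    then show "?S z" by blast
  next
    assume "\<exists>a r c d b. ?N (pr a b) \<and>
      list_all2 (\<lambda>x y. ?T (pr a (pr x y))) (list_decode c) (list_decode d) \<and>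
      z = pr a (pr (pr 2 (pr r c)) (pr 2 (pr r d)))"
    then obtain q r c d where z: "z = pr (enc q) (pr (pr 2 (pr r c)) (pr 2 (pr r d)))"
      and l: "list_all2 (\<lambda>x y. ?T (pr (enc q) (pr x y))) (list_decode c) (list_decode d)" by auto
    have "list_all2 (\<lambda>x y. \<exists>t. x = gn_tm t \<and> y = gn_tm (F q t)) (list_decode c) (list_decode d)"
      using l by (simp add: inj_eq[OF enc] cong: list.rel_cong)
    then obtain ts where "list_decode c = map gn_tm ts" "list_decode d = map gn_tm (map (F q) ts)"
      unfolding list_all2_gn_tm by blast
    then have "c = list_encode (map gn_tm ts)" "d = list_encode (map gn_tm (map (F q) ts))"
      by (metis list_decode_inverse)+
    then have "z = pr (enc q) (pr (gn (Rel r ts)) (gn (G q (Rel r ts))))"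
      by (simp add: z G)
    then show "?S z" by blast
  next
    assume "\<exists>a s s' t t'. ?S (pr a (pr s s')) \<and> ?S (pr a (pr t t')) \<and>
      z = pr a (pr (pr 3 (pr s t)) (pr 3 (pr s' t')))"
    then obtain q \<phi> \<psi> where "z = pr (enc q) (pr (gn (Imp \<phi> \<psi>)) (gn (G q (Imp \<phi> \<psi>))))"
      by (auto simp: G inj_eq[OF enc])
    then show "?S z" by blast
  next
    assume "\<exists>a b s s'. ?N (pr a b) \<and> ?S (pr b (pr s s')) \<and> z = pr a (pr (pr 4 s) (pr 4 s'))"
    then obtain q \<phi> where "z = pr (enc q) (pr (gn (All \<phi>)) (gn (G q (All \<phi>))))"
      by (auto simp: G inj_eq[OF enc])
    then show "?S z" by blast
  qed
  show "P z" if P: "\<And>z. ?J P z \<Longrightarrow> P z" and z: "?S z" for P z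
  proof -
    have "P (pr (enc q) (pr (gn \<phi>) (gn (G q \<phi>))))" for q \<phi>
    proof (induction \<phi> arbitrary: q)
      case Bot show ?case by (intro P disjI1) (auto simp: G)
    next
      case (Eq s t) show ?case by (rule P, rule disjI2, rule disjI1) (auto simp: G)
    next
      case (Rel r ts)
      have *: "list_all2 (\<lambda>x y. ?T (pr (enc q) (pr x y))) (map gn_tm ts) (map gn_tm (map (F q) ts))"
        by (auto simp: list_all2_conv_all_nth)
      show ?case
        by (rule P, rule disjI2, rule disjI2, rule disjI1, intro exI[of _ "enc q"] exI[of _ r]
            exI[of _ "list_encode (map gn_tm ts)"] exI[of _ "list_encode (map gn_tm (map (F q) ts))"]
            exI[of _ "enc (next q)"]) (use * in \<open>auto simp: G\<close>)
    next
      case (Imp \<phi> \<psi>) then show ?case by (intro P) (auto simp: G)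
    next
      case (All \<phi>) then show ?case by (intro P) (auto simp: G)
    qed
    then show ?thesis using z by blast
  qed
qed

section \<open>Lifting and substitution as relations on codes\<close>

definition gn_lift_tm :: "nat \<Rightarrow> bool" where
  "gn_lift_tm z \<longleftrightarrow> (\<exists>k t. z = pr k (pr (gn_tm t) (gn_tm (lift_tm k t))))"

definition gn_lift :: "nat \<Rightarrow> bool" where
  "gn_lift z \<longleftrightarrow> (\<exists>k \<phi>. z = pr k (pr (gn \<phi>) (gn (lift k \<phi>))))"

definition gn_subst :: "nat \<Rightarrow> bool" where
  "gn_subst z \<longleftrightarrow> (\<exists>k s \<phi>. z = pr (pr k (gn_tm s)) (pr (gn \<phi>) (gn (subst k s \<phi>))))"

lemma semirec_gn_lift_tm: "semirec gn_lift_tm"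
proof -
  have "semirec (\<lambda>z. \<exists>k. \<exists>i. z = pr k (pr i (pr 0 i)) \<and> i < k \<or>
      z = pr k (pr i (pr 0 (Suc i))) \<and> k < Suc i)"
    by (intro semirec_ex semirec_conj semirec_disj semirec_eq semirec_less recursive1_intros)
  moreover have "(\<exists>k. \<exists>i. z = pr k (pr i (pr 0 i)) \<and> i < k \<or> z = pr k (pr i (pr 0 (Suc i))) \<and> k < Suc i)
      \<longleftrightarrow> (\<exists>k i. z = pr k (pr i (gn_tm (lift_tm k (Var i)))))" for z
    by auto (metis not_less_eq)+
  ultimately have "semirec (\<lambda>z. \<exists>k i. z = pr k (pr i (gn_tm (lift_tm k (Var i)))))" by simp
  from semirec_tm_op[OF inj_on_id2 this] show ?thesis unfolding gn_lift_tm_def by simp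
qed

lemma semirec_gn_lift: "semirec gn_lift"
proof -
  have "semirec (\<lambda>z. \<exists>k. z = pr k (Suc k))"
    by (intro semirec_ex semirec_eq recursive1_intros)
  from semirec_fm_op[OF inj_on_id2 semirec_gn_lift_tm[unfolded gn_lift_tm_def] this, of lift]
  show ?thesis unfolding gn_lift_def by simp
qed

text \<open>The parameter is the pair of level and substituted term. Passing a quantifier lifts that
  term, so the step relation rests on the graph of lifting.\<close>

lemma semirec_gn_subst: "semirec gn_subst"
proof -
  let ?enc = "\<lambda>q. pr (fst q) (gn_tm (snd q))"
  have enc: "inj ?enc" by (auto intro!: injI simp: inj_eq[OF inj_gn_tm] prod_eq_iff)
  let ?F = "\<lambda>q. subst_tm (fst q) (snd q)"
  let ?next = "\<lambda>q. (Suc (fst q), lift_tm 0 (snd q))"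
  \<comment> \<open>The conjunct on \<open>gn_lift_tm\<close> is there to make \<open>a\<close> the
    code of a term; its output \<open>b\<close> is discarded.\<close>
  let ?V = "\<lambda>z k a i b c. gn_lift_tm (pr 0 (pr a b)) \<and> z = pr (pr k a) (pr i c) \<and>
      (i < k \<and> c = pr 0 i \<or> i = k \<and> c = a \<or> k < i \<and> c = pr 0 (i - 1))"
  have "semirec (\<lambda>z. \<exists>k. \<exists>a. \<exists>i. \<exists>b. \<exists>c. ?V z k a i b c)"
    by (intro semirec_ex semirec_conj semirec_disj semirec_eq semirec_less recursive1_intros
      semirec_comp[OF semirec_gn_lift_tm])
  moreover have "(\<exists>q i. z = pr (?enc q) (pr i (gn_tm (?F q (Var i))))) \<longleftrightarrow>
      (\<exists>k a i b c. ?V z k a i b c)" (is "?l \<longleftrightarrow> ?r") for z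
  proof
    assume ?r
    then obtain k s i c where "z = pr (pr k (gn_tm s)) (pr i c)"
      "i < k \<and> c = pr 0 i \<or> i = k \<and> c = gn_tm s \<or> k < i \<and> c = pr 0 (i - 1)"
      unfolding gn_lift_tm_def by auto
    then show ?l by (intro exI[of _ "(k, s)"] exI[of _ i]) auto
  next
    assume ?l
    then obtain k s i where "z = pr (pr k (gn_tm s)) (pr i (gn_tm (subst_tm k s (Var i))))" by auto
    then have "?V z k (gn_tm s) i (gn_tm (lift_tm 0 s)) (gn_tm (subst_tm k s (Var i)))"
      unfolding gn_lift_tm_def by auto
    then show ?r by blast
  qed
  ultimately have var: "semirec (\<lambda>z. \<exists>q i. z = pr (?enc q) (pr i (gn_tm (?F q (Var i)))))"
    by (rule semirec_cong)
  have tm: "semirec (\<lambda>z. \<exists>q t. z = pr (?enc q) (pr (gn_tm t) (gn_tm (?F q t))))"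
    by (rule semirec_tm_op[OF enc var]) simp
  have "semirec (\<lambda>z. \<exists>k. \<exists>a. \<exists>b. z = pr (pr k a) (pr (Suc k) b) \<and> gn_lift_tm (pr 0 (pr a b)))"
    by (intro semirec_ex semirec_conj semirec_eq recursive1_intros semirec_comp[OF semirec_gn_lift_tm])
  moreover have "(\<exists>k. \<exists>a. \<exists>b. z = pr (pr k a) (pr (Suc k) b) \<and> gn_lift_tm (pr 0 (pr a b))) \<longleftrightarrow>
      (\<exists>q. z = pr (?enc q) (?enc (?next q)))" for z
    unfolding gn_lift_tm_def by auto
  ultimately have step: "semirec (\<lambda>z. \<exists>q. z = pr (?enc q) (?enc (?next q)))" by simp
  have "semirec (\<lambda>z. \<exists>q \<phi>. z = pr (?enc q) (pr (gn \<phi>) (gn (subst (fst q) (snd q) \<phi>))))"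
    by (rule semirec_fm_op[OF enc tm step]) simp_all
  then show ?thesis unfolding gn_subst_def by simp
qed


lemma gn_lift_iff: "gn_lift (pr k (pr (gn \<phi>) b)) \<longleftrightarrow> b = gn (lift k \<phi>)"
  by (auto simp: gn_lift_def inj_eq[OF inj_gn])

lemma gn_subst_iff: "gn_subst (pr (pr k (gn_tm s)) (pr (gn \<phi>) b)) \<longleftrightarrow> b = gn (subst k s \<phi>)"
  by (auto simp: gn_subst_def inj_eq[OF inj_gn] inj_eq[OF inj_gn_tm])

section \<open>Codes of terms, formulas and sentences of the language\<close>

definition gn_tm_in :: "lang \<Rightarrow> nat \<Rightarrow> bool" where
  "gn_tm_in L z \<longleftrightarrow> (\<exists>k t. z = pr k (gn_tm t) \<and> tm_in L t \<and> fv_tm t \<subseteq> {..<k})"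

text \<open>The bound \<open>k\<close> on the free variables makes one induction serve two purposes:
  \<open>k = 0\<close> gives the sentences, and an unspecified \<open>k\<close> gives all formulas,
  as each has finitely many free variables. Under a quantifier the bound grows by one.\<close>

definition gn_fm_in :: "lang \<Rightarrow> nat \<Rightarrow> bool" where
  "gn_fm_in L z \<longleftrightarrow> (\<exists>k \<phi>. z = pr k (gn \<phi>) \<and> fm_in L \<phi> \<and> fv \<phi> \<subseteq> {..<k})"

lemma gn_tm_in_list:
  assumes "\<forall>y\<in>set ys. gn_tm_in L (pr k y)"
  obtains ts where "ys = map gn_tm ts" "\<forall>t\<in>set ts. tm_in L t \<and> fv_tm t \<subseteq> {..<k}"
proof -
  have "\<forall>y\<in>set ys. \<exists>t. tm_in L t \<and> fv_tm t \<subseteq> {..<k} \<and> y = gn_tm t"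
    using assms by (auto simp: gn_tm_in_def)
  then have "\<exists>ts. ys = map gn_tm ts \<and> (\<forall>t\<in>set ts. tm_in L t \<and> fv_tm t \<subseteq> {..<k})"
  proof (induction ys)
    case (Cons y ys)
    then obtain t ts where "y # ys = map gn_tm (t # ts)"
      "\<forall>t\<in>set (t # ts). tm_in L t \<and> fv_tm t \<subseteq> {..<k}" by auto
    then show ?case by (intro exI[of _ "t # ts"] conjI)
  qed simp
  then show ?thesis using that by blast
qed

lemma semirec_gn_tm_in:
  assumes L: "recursive_lang L" shows "semirec (gn_tm_in L)"
proof (rule semirec_least)
  have funs: "semirec (\<lambda>z. z \<in> prod_encode ` funs L)"
    using L by (simp add: recursive_lang_def semirec_recursive_set)
  let ?J = "\<lambda>X z. (\<exists>k. \<exists>i. i < k \<and> z = pr k (pr 0 i)) \<or>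
    (\<exists>k. \<exists>f. \<exists>c. pr f (length (list_decode c)) \<in> prod_encode ` funs L \<and>
      (\<forall>y\<in>set (list_decode c). X (pr k y)) \<and> z = pr k (pr 1 (pr f c)))"
  show "enum_op ?J" by (intro enum_op_intros enum_op_semirec[OF funs])
  show "gn_tm_in L z" if "?J (gn_tm_in L) z" for z
    using that
  proof (elim disjE exE conjE)
    fix k i assume "i < k" "z = pr k (pr 0 i)"
    then show ?thesis unfolding gn_tm_in_def by (intro exI[of _ k] exI[of _ "Var i"]) auto
  next
    fix k f c assume f: "pr f (length (list_decode c)) \<in> prod_encode ` funs L"
      and c: "\<forall>y\<in>set (list_decode c). gn_tm_in L (pr k y)" and z: "z = pr k (pr 1 (pr f c))"
    from c obtain ts where ts: "list_decode c = map gn_tm ts"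
      "\<forall>t\<in>set ts. tm_in L t \<and> fv_tm t \<subseteq> {..<k}" by (rule gn_tm_in_list)
    then have "c = list_encode (map gn_tm ts)" by (metis list_decode_inverse)
    then show ?thesis
      unfolding gn_tm_in_def using f ts(2) z by (intro exI[of _ k] exI[of _ "Fun f ts"]) auto
  qed
  show "P z" if P: "\<And>z. ?J P z \<Longrightarrow> P z" and z: "gn_tm_in L z" for P z
  proof -
    have "tm_in L t \<Longrightarrow> fv_tm t \<subseteq> {..<k} \<Longrightarrow> P (pr k (gn_tm t))" for k t
    proof (induction t)
      case (Var i) then show ?case by (intro P) auto
    next
      case (Fun f ts)
      show ?case
        by (rule P, rule disjI2, intro exI[of _ k] exI[of _ f] exI[of _ "list_encode (map gn_tm ts)"])
          (use Fun in \<open>auto simp: UN_subset_iff\<close>)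
    qed
    then show ?thesis using z unfolding gn_tm_in_def by blast
  qed
qed

lemma semirec_gn_fm_in:
  assumes L: "recursive_lang L" shows "semirec (gn_fm_in L)"
proof (rule semirec_least)
  have rels: "semirec (\<lambda>z. z \<in> prod_encode ` rels L)"
    using L by (simp add: recursive_lang_def semirec_recursive_set)
  have fv_All: "fv (All \<phi>) \<subseteq> {..<k} \<longleftrightarrow> fv \<phi> \<subseteq> {..<Suc k}" for \<phi> k
  proof
    assume "fv (All \<phi>) \<subseteq> {..<k}"
    then have "j < Suc k" if "j \<in> fv \<phi>" for j using that by (cases j) auto
    then show "fv \<phi> \<subseteq> {..<Suc k}" by blast
  qed auto
  let ?J = "\<lambda>X z. (\<exists>k. z = pr k (pr 0 0)) \<or>
    (\<exists>k. \<exists>s. \<exists>t. gn_tm_in L (pr k s) \<and> gn_tm_in L (pr k t) \<and> z = pr k (pr 1 (pr s t))) \<or>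
    (\<exists>k. \<exists>r. \<exists>c. pr r (length (list_decode c)) \<in> prod_encode ` rels L \<and>
      (\<forall>y\<in>set (list_decode c). gn_tm_in L (pr k y)) \<and> z = pr k (pr 2 (pr r c))) \<or>
    (\<exists>k. \<exists>a. \<exists>b. X (pr k a) \<and> X (pr k b) \<and> z = pr k (pr 3 (pr a b))) \<or>
    (\<exists>k. \<exists>a. X (pr (Suc k) a) \<and> z = pr k (pr 4 a))"
  show "enum_op ?J"
    by (intro enum_op_intros enum_op_semirec[OF rels] enum_op_semirec[OF semirec_gn_tm_in[OF L]])
  show "gn_fm_in L z" if "?J (gn_fm_in L) z" for z
    using that
  proof (elim disjE exE conjE)
    fix k assume "z = pr k (pr 0 0)"
    then show ?thesis unfolding gn_fm_in_def by (intro exI[of _ k] exI[of _ Bot]) auto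
  next
    fix k s t assume "gn_tm_in L (pr k s)" "gn_tm_in L (pr k t)" "z = pr k (pr 1 (pr s t))"
    then obtain s' t' where "z = pr k (gn (Eq s' t'))" "fm_in L (Eq s' t')" "fv (Eq s' t') \<subseteq> {..<k}"
      by (auto simp: gn_tm_in_def)
    then show ?thesis unfolding gn_fm_in_def by blast
  next
    fix k r c assume r: "pr r (length (list_decode c)) \<in> prod_encode ` rels L"
      and c: "\<forall>y\<in>set (list_decode c). gn_tm_in L (pr k y)" and z: "z = pr k (pr 2 (pr r c))"
    from c obtain ts where ts: "list_decode c = map gn_tm ts"
      "\<forall>t\<in>set ts. tm_in L t \<and> fv_tm t \<subseteq> {..<k}" by (rule gn_tm_in_list)
    then have "c = list_encode (map gn_tm ts)" by (metis list_decode_inverse)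
    then show ?thesis
      unfolding gn_fm_in_def using r ts(2) z by (intro exI[of _ k] exI[of _ "Rel r ts"]) auto
  next
    fix k a b assume "gn_fm_in L (pr k a)" "gn_fm_in L (pr k b)" "z = pr k (pr 3 (pr a b))"
    then obtain \<phi> \<psi> where "z = pr k (gn (Imp \<phi> \<psi>))" "fm_in L (Imp \<phi> \<psi>)" "fv (Imp \<phi> \<psi>) \<subseteq> {..<k}"
      by (auto simp: gn_fm_in_def)
    then show ?thesis unfolding gn_fm_in_def by blast
  next
    fix k a assume "gn_fm_in L (pr (Suc k) a)" "z = pr k (pr 4 a)"
    then obtain \<phi> where "z = pr k (gn (All \<phi>))" "fm_in L (All \<phi>)" "fv (All \<phi>) \<subseteq> {..<k}"
      unfolding fv_All by (auto simp: gn_fm_in_def)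
    then show ?thesis unfolding gn_fm_in_def by blast
  qed
  show "P z" if P: "\<And>z. ?J P z \<Longrightarrow> P z" and z: "gn_fm_in L z" for P z
  proof -
    have "fm_in L \<phi> \<Longrightarrow> fv \<phi> \<subseteq> {..<k} \<Longrightarrow> P (pr k (gn \<phi>))" for k \<phi>
    proof (induction \<phi> arbitrary: k)
      case Bot show ?case by (intro P) auto
    next
      case (Eq s t)
      then show ?case by (intro P) (auto simp: gn_tm_in_def)
    next
      case (Rel r ts)
      show ?case
        by (rule P, rule disjI2, rule disjI2, rule disjI1,
            intro exI[of _ k] exI[of _ r] exI[of _ "list_encode (map gn_tm ts)"])
          (use Rel in \<open>auto simp: gn_tm_in_def UN_subset_iff\<close>)
    next
      case (Imp \<phi> \<psi>) then show ?case by (intro P) auto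
    next
      case (All \<phi>)
      then have "P (pr (Suc k) (gn \<phi>))" unfolding fv_All by simp
      then show ?case by (intro P) auto
    qed
    then show ?thesis using z unfolding gn_fm_in_def by blast
  qed
qed

lemma finite_fv_tm: "finite (fv_tm t)"
  by (induction t) auto

lemma finite_fv: "finite (fv \<phi>)"
proof (induction \<phi>)
  case (All \<phi>)
  then show ?case using finite_vimageI[of "fv \<phi>" Suc] by (simp add: vimage_def)
qed (auto simp: finite_fv_tm)

lemma gn_tm_in_ex_iff: "(\<exists>k. gn_tm_in L (pr k a)) \<longleftrightarrow> (\<exists>t. a = gn_tm t \<and> tm_in L t)"
  unfolding gn_tm_in_def using finite_nat_bounded[OF finite_fv_tm] by auto blast

lemma gn_fm_in_ex_iff: "(\<exists>k. gn_fm_in L (pr k a)) \<longleftrightarrow> (\<exists>\<phi>. a = gn \<phi> \<and> fm_in L \<phi>)"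
  unfolding gn_fm_in_def using finite_nat_bounded[OF finite_fv] by auto blast

lemma gn_sentence_iff: "gn_fm_in L (pr 0 a) \<longleftrightarrow> (\<exists>\<phi>. a = gn \<phi> \<and> sentence L \<phi>)"
  by (auto simp: gn_fm_in_def sentence_def)


section \<open>Provability\<close>

abbreviation imp_code :: "nat \<Rightarrow> nat \<Rightarrow> nat" where "imp_code a b \<equiv> pr 3 (pr a b)"
abbreviation neg_code :: "nat \<Rightarrow> nat" where "neg_code a \<equiv> imp_code a (pr 0 0)"
abbreviation and_code :: "nat \<Rightarrow> nat \<Rightarrow> nat" where
  "and_code a b \<equiv> neg_code (imp_code a (neg_code b))"
abbreviation ex_code :: "nat \<Rightarrow> nat" where "ex_code a \<equiv> neg_code (pr 4 (neg_code a))"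

text \<open>The disjuncts of \<open>?J\<close> are the axioms and rules of \<open>provable\<close>
  in order, with the graphs of substitution and lifting where the calculus uses these
  operations.\<close>

lemma semirec_provable:
  assumes "RE_theory L T" shows "semirec (\<lambda>z. \<exists>\<phi>. z = gn \<phi> \<and> provable L T \<phi>)" (is "semirec ?S")
proof (rule semirec_least)
  let ?F = "\<lambda>a. \<exists>\<phi>. a = gn \<phi> \<and> fm_in L \<phi>"
  let ?T = "\<lambda>a. \<exists>t. a = gn_tm t \<and> tm_in L t"
  have L: "recursive_lang L" and "RE (gn ` T)" using assms by (auto simp: RE_theory_def)
  then have ax: "semirec (\<lambda>z. z \<in> gn ` T)" by (simp add: RE_iff_semirec)
  have F: "semirec ?F"
    unfolding gn_fm_in_ex_iff[symmetric]
    by (intro semirec_ex semirec_comp[OF semirec_gn_fm_in[OF L]] recursive1_intros)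
  have T: "semirec ?T"
    unfolding gn_tm_in_ex_iff[symmetric]
    by (intro semirec_ex semirec_comp[OF semirec_gn_tm_in[OF L]] recursive1_intros)
  let ?J = "\<lambda>X z. z \<in> gn ` T \<or>
    (\<exists>a. \<exists>b. ?F a \<and> ?F b \<and> z = imp_code a (imp_code b a)) \<or>
    (\<exists>a. \<exists>b. \<exists>c. ?F a \<and> ?F b \<and> ?F c \<and>
      z = imp_code (imp_code a (imp_code b c)) (imp_code (imp_code a b) (imp_code a c))) \<or>
    (\<exists>a. ?F a \<and> z = imp_code (neg_code (neg_code a)) a) \<or>
    (\<exists>a. \<exists>t. \<exists>b. ?F a \<and> ?T t \<and> gn_subst (pr (pr 0 t) (pr a b)) \<and> z = imp_code (pr 4 a) b) \<or>
    (\<exists>a. \<exists>b. ?F a \<and> ?F b \<and> z = imp_code (pr 4 (imp_code a b)) (imp_code (pr 4 a) (pr 4 b))) \<or>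
    (\<exists>a. \<exists>b. ?F a \<and> gn_lift (pr 0 (pr a b)) \<and> z = imp_code a (pr 4 b)) \<or>
    (\<exists>t. ?T t \<and> z = pr 1 (pr t t)) \<or>
    (\<exists>a. \<exists>s. \<exists>t. \<exists>b. \<exists>c. ?F a \<and> ?T s \<and> ?T t \<and> gn_subst (pr (pr 0 s) (pr a b)) \<and>
      gn_subst (pr (pr 0 t) (pr a c)) \<and> z = imp_code (pr 1 (pr s t)) (imp_code b c)) \<or>
    (\<exists>a. X (imp_code a z) \<and> X a) \<or>
    (\<exists>a. X a \<and> z = pr 4 a)"
  show "enum_op ?J"
    by (intro enum_op_disj enum_op_ex enum_op_conj enum_op_eq enum_op_arg recursive1_list
      enum_op_semirec[OF F] enum_op_semirec[OF T] enum_op_semirec[OF ax]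
      enum_op_semirec[OF semirec_gn_subst] enum_op_semirec[OF semirec_gn_lift])
  have S: "z = gn \<chi> \<Longrightarrow> provable L T \<chi> \<Longrightarrow> ?S z" for z \<chi> by blast
  show "?S z" if "?J ?S z" for z
    using that
  proof (elim disjE)
    assume "z \<in> gn ` T" then show ?thesis using provable.ax by blast
  next
    assume "\<exists>a b. ?F a \<and> ?F b \<and> z = imp_code a (imp_code b a)"
    then obtain \<phi> \<psi> where "fm_in L \<phi>" "fm_in L \<psi>" "z = gn (Imp \<phi> (Imp \<psi> \<phi>))" by auto
    then show ?thesis using provable.imp_K by blast
  next
    assume "\<exists>a b c. ?F a \<and> ?F b \<and> ?F c \<and>
      z = imp_code (imp_code a (imp_code b c)) (imp_code (imp_code a b) (imp_code a c))"
    then obtain \<phi> \<psi> \<chi> where "fm_in L \<phi>" "fm_in L \<psi>" "fm_in L \<chi>"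
      "z = gn (Imp (Imp \<phi> (Imp \<psi> \<chi>)) (Imp (Imp \<phi> \<psi>) (Imp \<phi> \<chi>)))" by auto
    then show ?thesis using provable.imp_S by blast
  next
    assume "\<exists>a. ?F a \<and> z = imp_code (neg_code (neg_code a)) a"
    then obtain \<phi> where "fm_in L \<phi>" "z = gn (Imp (Neg (Neg \<phi>)) \<phi>)" by auto
    then show ?thesis using provable.dneg by blast
  next
    assume "\<exists>a t b. ?F a \<and> ?T t \<and> gn_subst (pr (pr 0 t) (pr a b)) \<and> z = imp_code (pr 4 a) b"
    then obtain \<phi> t where "fm_in L \<phi>" "tm_in L t" "z = gn (Imp (All \<phi>) (subst 0 t \<phi>))"
      by (auto simp: gn_subst_iff)
    then show ?thesis using provable.all_inst by blast
  next
    assume "\<exists>a b. ?F a \<and> ?F b \<and> z = imp_code (pr 4 (imp_code a b)) (imp_code (pr 4 a) (pr 4 b))"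
    then obtain \<phi> \<psi> where "fm_in L \<phi>" "fm_in L \<psi>"
      "z = gn (Imp (All (Imp \<phi> \<psi>)) (Imp (All \<phi>) (All \<psi>)))" by auto
    then show ?thesis using provable.all_imp by blast
  next
    assume "\<exists>a b. ?F a \<and> gn_lift (pr 0 (pr a b)) \<and> z = imp_code a (pr 4 b)"
    then obtain \<phi> where "fm_in L \<phi>" "z = gn (Imp \<phi> (All (lift 0 \<phi>)))" by (auto simp: gn_lift_iff)
    then show ?thesis using provable.all_vac by blast
  next
    assume "\<exists>t. ?T t \<and> z = pr 1 (pr t t)"
    then obtain t where "tm_in L t" "z = gn (Eq t t)" by auto
    then show ?thesis using provable.eq_refl by blast
  next
    assume "\<exists>a s t b c. ?F a \<and> ?T s \<and> ?T t \<and> gn_subst (pr (pr 0 s) (pr a b)) \<and>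
      gn_subst (pr (pr 0 t) (pr a c)) \<and> z = imp_code (pr 1 (pr s t)) (imp_code b c)"
    then obtain \<phi> s t where "fm_in L \<phi>" "tm_in L s" "tm_in L t"
      "z = gn (Imp (Eq s t) (Imp (subst 0 s \<phi>) (subst 0 t \<phi>)))" by (auto simp: gn_subst_iff)
    then show ?thesis using provable.eq_subst by blast
  next
    assume "\<exists>a. ?S (imp_code a z) \<and> ?S a"
    then obtain \<chi> \<phi> where \<chi>: "imp_code (gn \<phi>) z = gn \<chi>" "provable L T \<chi>" "provable L T \<phi>" by auto
    \<comment> \<open>A provable formula whose code has tag 3 is an implication, and injectivity of
      \<open>gn\<close> shows its antecedent to be the \<open>\<phi>\<close> already proved.\<close>
    then obtain \<psi> where "\<chi> = Imp \<phi> \<psi>" "z = gn \<psi>"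
      by (cases \<chi>) (auto simp: inj_eq[OF inj_gn])
    then show ?thesis using provable.mp \<chi> by blast
  next
    assume "\<exists>a. ?S a \<and> z = pr 4 a"
    then obtain \<phi> where "provable L T \<phi>" "z = gn (All \<phi>)" by auto
    then show ?thesis using provable.gen by blast
  qed
  show "P z" if P: "\<And>z. ?J P z \<Longrightarrow> P z" and z: "?S z" for P z
  proof -
    have "P (gn \<phi>)" if "provable L T \<phi>" for \<phi>
      using that
    proof (induction rule: provable.induct)
      case (ax \<phi>) then show ?case by (intro P) auto
    next
      case (imp_K \<phi> \<psi>)
      show ?case
        by (rule P, rule disjI2, rule disjI1)
          (use imp_K in \<open>auto\<close>)
    next
      case (imp_S \<phi> \<psi> \<chi>)
      show ?case
        by (rule P, rule disjI2, rule disjI2, rule disjI1)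
          (use imp_S in \<open>auto\<close>)
    next
      case (dneg \<phi>)
      show ?case
        by (rule P, rule disjI2, rule disjI2, rule disjI2, rule disjI1)
          (use dneg in \<open>auto\<close>)
    next
      case (all_inst \<phi> t)
      show ?case
        by (rule P, rule disjI2, rule disjI2, rule disjI2, rule disjI2, rule disjI1,
            intro exI[of _ "gn \<phi>"] exI[of _ "gn_tm t"] exI[of _ "gn (subst 0 t \<phi>)"])
          (use all_inst in \<open>auto simp: gn_subst_iff\<close>)
    next
      case (all_imp \<phi> \<psi>)
      show ?case
        by (rule P, rule disjI2, rule disjI2, rule disjI2, rule disjI2, rule disjI2, rule disjI1)
          (use all_imp in \<open>auto\<close>)
    next
      case (all_vac \<phi>)
      show ?case
        by (rule P, rule disjI2, rule disjI2, rule disjI2, rule disjI2, rule disjI2, rule disjI2, rule disjI1)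
          (use all_vac in \<open>auto simp: gn_lift_iff\<close>)
    next
      case (eq_refl t)
      show ?case
        by (rule P, rule disjI2, rule disjI2, rule disjI2, rule disjI2, rule disjI2, rule disjI2, rule disjI2, rule disjI1)
          (use eq_refl in \<open>auto\<close>)
    next
      case (eq_subst \<phi> s t)
      show ?case
        by (rule P, rule disjI2, rule disjI2, rule disjI2, rule disjI2, rule disjI2, rule disjI2, rule disjI2, rule disjI2, rule disjI1)
          (use eq_subst in \<open>auto simp: gn_subst_iff\<close>)
    next
      case (mp \<phi> \<psi>)
      show ?case
        by (rule P, rule disjI2, rule disjI2, rule disjI2, rule disjI2, rule disjI2, rule disjI2, rule disjI2, rule disjI2, rule disjI2, rule disjI1)
          (use mp in \<open>auto\<close>)
    next
      case (gen \<phi>) then show ?case by (intro P) auto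
    qed
    then show ?thesis using z by blast
  qed
qed

text \<open>Derivations pass through open formulas, so the restriction to sentences is imposed
  afterwards, with bound 0 on the free variables.\<close>

lemma RE_provables:
  assumes "RE_theory L T" shows "RE (provables L T)"
proof -
  have L: "recursive_lang L" using assms by (auto simp: RE_theory_def)
  have "semirec (\<lambda>z. gn_fm_in L (pr 0 z) \<and> (\<exists>\<phi>. z = gn \<phi> \<and> provable L T \<phi>))"
    by (intro semirec_conj semirec_comp[OF semirec_gn_fm_in[OF L]]
        semirec_provable[OF assms] recursive1_intros)
  moreover have "z \<in> provables L T \<longleftrightarrow>
      gn_fm_in L (pr 0 z) \<and> (\<exists>\<phi>. z = gn \<phi> \<and> provable L T \<phi>)" for z
    by (auto simp: provables_def gn_sentence_iff inj_eq[OF inj_gn])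
  ultimately show ?thesis unfolding RE_iff_semirec by (rule semirec_cong)
qed

lemma RE_refutables:
  assumes "RE_theory L T" shows "RE (refutables L T)"
proof -
  have L: "recursive_lang L" using assms by (auto simp: RE_theory_def)
  have "semirec (\<lambda>z. gn_fm_in L (pr 0 z) \<and> (\<exists>\<phi>. neg_code z = gn \<phi> \<and> provable L T \<phi>))"
    by (intro semirec_conj semirec_comp[OF semirec_gn_fm_in[OF L]]
        semirec_comp[OF semirec_provable[OF assms]] recursive1_intros)
  moreover have neg: "neg_code (gn \<phi>) = gn \<psi> \<longleftrightarrow> \<psi> = Neg \<phi>" for \<phi> \<psi>
    using inj_eq[OF inj_gn, of "Neg \<phi>" \<psi>] by auto
  have "z \<in> refutables L T \<longleftrightarrow>
      gn_fm_in L (pr 0 z) \<and> (\<exists>\<phi>. neg_code z = gn \<phi> \<and> provable L T \<phi>)" for z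
    unfolding gn_sentence_iff by (auto simp: refutables_def neg simp del: gn.simps)
  ultimately show ?thesis unfolding RE_iff_semirec by (rule semirec_cong)
qed


section \<open>Numeral instances\<close>

lemma ren_tm_fv: "fv_tm (ren_tm r t) = r ` fv_tm t"
  by (induction t) auto

lemma ren_tm_in: "tm_in L (ren_tm r t) = tm_in L t"
  by (induction t) auto

lemma ren_fm_in: "fm_in L (ren r \<phi>) = fm_in L \<phi>"
  by (induction \<phi> arbitrary: r) (auto simp: ren_tm_in)

lemma ren_fv: "fv (ren r \<phi>) = r ` fv \<phi>"
proof (induction \<phi> arbitrary: r)
  case (All \<phi>)
  have "Suc i \<in> case_nat 0 (\<lambda>i. Suc (r i)) ` fv \<phi> \<longleftrightarrow> i \<in> r ` {i. Suc i \<in> fv \<phi>}" for i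
  proof
    assume "Suc i \<in> case_nat 0 (\<lambda>i. Suc (r i)) ` fv \<phi>"
    then obtain j where "j \<in> fv \<phi>" "Suc i = case_nat 0 (\<lambda>i. Suc (r i)) j" by blast
    then show "i \<in> r ` {i. Suc i \<in> fv \<phi>}" by (cases j) auto
  qed force
  then show ?case by (auto simp: All)
qed (auto simp: ren_tm_fv)

lemma at_fm_in: "fm_in L (at \<phi> xs) = fm_in L \<phi>"
  by (simp add: at_def ren_fm_in)

lemma at_fv: "fv (at \<phi> xs) = (!) xs ` fv \<phi>"
  by (simp add: at_def ren_fv)

context
  fixes L :: lang and I :: translation
  assumes I: "translation_into L I"
begin

lemma fv_at_dom: "fv (at (tr_dom I) [y]) \<subseteq> {y}"
  using I by (auto simp: translation_into_def at_fv)

lemma fv_val_numeral: "fv (val I d (numeral_tm a) y) \<subseteq> {y}"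
proof (induction a arbitrary: d y)
  case 0 show ?case using I by (auto simp: translation_into_def at_fv)
next
  case (Suc a)
  have "fv (at (tr_succ I) [0, Suc y]) \<subseteq> {0, Suc y}"
    using I by (auto simp: translation_into_def at_fv nth_Cons')
  then show ?case using Suc[of "Suc d" 0] fv_at_dom[of 0] by auto
qed

lemma fm_in_val_numeral: "fm_in L (val I d (numeral_tm a) y)"
  using I by (induction a arbitrary: d y) (auto simp: translation_into_def at_fm_in)

text \<open>\<open>provables\<close> and \<open>refutables\<close> contain codes of sentences only.
  The conjunct for \<open>i\<close> has no free variable but \<open>i\<close>, and the
  \<open>n\<close> quantifiers bind all variables below \<open>n\<close>.\<close>

lemma sentence_num_inst:
  assumes "fm_in L \<phi>" "fv \<phi> \<subseteq> {..<length as}" shows "sentence L (num_inst I \<phi> as)"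
proof -
  have fm: "fm_in L ((Ex ^^ n) \<psi>) = fm_in L \<psi>" for n \<psi> by (induction n) auto
  have fv: "fv \<psi> \<subseteq> {..<n} \<Longrightarrow> fv ((Ex ^^ n) \<psi>) = {}" for n \<psi>
  proof (induction n arbitrary: \<psi>)
    case (Suc n)
    then have "fv (Ex \<psi>) \<subseteq> {..<n}" by auto
    \<comment> \<open>The innermost quantifier is split off, so that the bound on the free variables
      drops before the induction hypothesis is used.\<close>
    then show ?case using Suc.IH[of "Ex \<psi>"] by (simp only: funpow_Suc_right o_apply)
  qed simp
  let ?A = "\<lambda>i. And (at (tr_dom I) [i]) (val I 0 (numeral_tm (as ! i)) i)"
  have A: "fm_in L (?A i)" "fv (?A i) \<subseteq> {i}" for i
    using I fv_at_dom fv_val_numeral fm_in_val_numeral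
    by (auto simp: translation_into_def at_fm_in)
  have "fm_in L (foldr (\<lambda>i \<psi>. And (?A i) \<psi>) is \<phi>)" for "is"
    using assms(1) A(1) by (induction "is") auto
  moreover have "fv (foldr (\<lambda>i \<psi>. And (?A i) \<psi>) is \<phi>) \<subseteq> {..<n}"
    if "set is \<subseteq> {..<n}" "fv \<phi> \<subseteq> {..<n}" for "is" n
    using that
  proof (induction "is")
    case (Cons i "is") then show ?case using A(2)[of i] by auto
  qed simp
  ultimately show ?thesis
    unfolding sentence_def num_inst_def using assms by (simp add: fm fv atLeast0LessThan)
qed

end

text \<open>Numerals are closed, while the depth only shifts variables of the term.\<close>

lemma val_numeral_depth: "val I d (numeral_tm a) y = val I 0 (numeral_tm a) y"
  by (induction a arbitrary: d y) (simp, metis numeral_tm.simps(2) val.simps(3))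

text \<open>Unfolding a successor numeral leads to an inner numeral whose value variable is 0. Hence
  primitive recursion settles \<open>y = 0\<close> first, and any other \<open>y\<close> takes one
  more step.\<close>

lemma recursive1_val_numeral:
  assumes "recursive1 f" shows "recursive1 (\<lambda>x. gn (val I 0 (numeral_tm (f x)) y))"
proof -
  let ?D = "gn (at (tr_dom I) [0])" and ?S = "\<lambda>y. gn (at (tr_succ I) [0, Suc y])"
  let ?step = "\<lambda>y u. ex_code (and_code ?D (and_code u (?S y)))"
  let ?V = "\<lambda>y a. gn (val I 0 (numeral_tm a) y)"
  have Suc: "?V y (Suc a) = ?step y (?V 0 a)" for y a
    by (simp add: val_numeral_depth[of I "Suc 0"])
  have "recursive1 (\<lambda>a. rec_nat (?V 0 0) (\<lambda>_ u. ?step 0 u) a)"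
    by (intro recursive1_rec recursive1_basic)
  moreover have "rec_nat (?V 0 0) (\<lambda>_ u. ?step 0 u) a = ?V 0 a" for a
    by (induction a) (simp_all only: Suc nat.rec)
  ultimately have V0: "recursive1 (?V 0)" by simp
  \<comment> \<open>The recursion ignores its previous value and is only a case distinction between
    zero and successor.\<close>
  have "recursive1 (\<lambda>a. rec_nat (?V y 0) (\<lambda>k _. ?step y (?V 0 k)) a)"
    by (intro recursive1_rec recursive1_basic recursive1_comp[OF V0])
  moreover have "rec_nat (?V y 0) (\<lambda>k _. ?step y (?V 0 k)) a = ?V y a" for a
    by (cases a) (simp_all only: Suc nat.rec)
  ultimately have "recursive1 (?V y)" by simp
  then show ?thesis using assms by (rule recursive1_comp)
qed

text \<open>\<open>num_inst\<close> transcribed to codes, for the tuple \<open>a, 0, ..., 0\<close>.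
  Numerals enter by conjuncts rather than by substitution, so the code \<open>e\<close> of the
  matrix is simply inserted, and the function makes sense for every number \<open>e\<close>.\<close>

definition num_code :: "translation \<Rightarrow> nat \<Rightarrow> nat \<Rightarrow> nat \<Rightarrow> nat" where
  "num_code I n e a = (ex_code ^^ n)
    (foldr (\<lambda>i u. and_code (and_code (gn (at (tr_dom I) [i]))
        (gn (val I 0 (numeral_tm ((a # replicate (n - 1) 0) ! i)) i))) u) [0..<n] e)"

lemma num_code:
  assumes "n \<ge> 1" shows "num_code I n (gn \<phi>) a = gn (num_inst I \<phi> (a # replicate (n - 1) 0))"
proof -
  have ex: "(ex_code ^^ m) (gn \<psi>) = gn ((Ex ^^ m) \<psi>)" for m \<psi> by (induction m) auto
  have "foldr (\<lambda>i u. and_code (and_code (gn (D i)) (gn (V i))) u) is (gn \<phi>) =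
      gn (foldr (\<lambda>i \<psi>. And (And (D i) (V i)) \<psi>) is \<phi>)" for D V and "is" :: "nat list"
    by (induction "is") auto
  then show ?thesis using assms by (simp add: num_code_def num_inst_def ex)
qed

text \<open>As \<open>n\<close> is fixed, the fold and the iterated quantifier are compositions of a
  fixed number of recursive functions; no recursion on codes is involved.\<close>

lemma recursive1_num_code:
  assumes "recursive1 e" "recursive1 f" shows "recursive1 (\<lambda>x. num_code I n (e x) (f x))"
proof -
  have V: "recursive1 (\<lambda>x. gn (val I 0 (numeral_tm ((f x # as) ! i)) i))" for as i
    by (cases i) (simp_all add: recursive1_val_numeral assms(2) recursive1_const)
  have fold: "recursive1 (\<lambda>x. foldr (\<lambda>i u. and_code (and_code (gn (D i)) (V i x)) u) is (e x))"
    if "\<And>i. recursive1 (V i)" for D V and "is" :: "nat list"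
    using assms(1) by (induction "is") (auto intro!: recursive1_basic that)
  have ex: "recursive1 (\<lambda>x. (ex_code ^^ m) (g x))" if "recursive1 g" for m g
    using that by (induction m) (auto intro!: recursive1_basic)
  show ?thesis unfolding num_code_def by (intro ex fold V)
qed

section \<open>The diagonal argument\<close>

lemma provables_refutables_disjoint:
  assumes "consistent L T" shows "provables L T \<inter> refutables L T = {}"
  using assms provable.mp by (fastforce simp: provables_def refutables_def consistent_def
      inj_eq[OF inj_gn])

theorem n_Rosser_imp_EI:
  assumes RE: "RE_theory L T" and con: "consistent L T" and n: "n \<ge> 1" and ros: "n_Rosser L T n"
  shows "EI_theory L T"
proof -
  obtain I where I: "translation_into L I"
    and sep: "\<And>M1 M2. RE_rel n M1 \<Longrightarrow> RE_rel n M2 \<Longrightarrow>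
      \<exists>\<phi>. strongly_separates L T I n \<phi> (M1 - M2) (M2 - M1)"
    using ros unfolding n_Rosser_def interprets_Num_def by blast
  let ?t = "\<lambda>a. a # replicate (n - 1) 0"
  \<comment> \<open>Here \<open>a\<close> stands for \<open>pr e (pr i j)\<close>, so
    \<open>pfst a\<close> is the formula code and \<open>w\<close> picks the index:
    \<open>pfst\<close> gives \<open>i\<close> and \<open>psnd\<close> gives
    \<open>j\<close>.\<close>
  let ?M = "\<lambda>w. {?t a |a. num_code I n (pfst a) a \<in> W (w (psnd a))}"
  have M: "RE_rel n (?M w)" if w: "recursive1 w" for w
  proof -
    have "semirec (\<lambda>z. \<exists>a. num_code I n (pfst a) a \<in> W (w (psnd a)) \<and>
        z = Suc (pr a (list_encode (replicate (n - 1) 0))))"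
      using semirec_comp[OF semirec_W, of
          "\<lambda>x. pr (w (psnd (psnd x))) (num_code I n (pfst (psnd x)) (psnd x))"]
      by (intro semirec_ex semirec_conj semirec_eq recursive1_basic)
        (simp add: recursive1_basic recursive1_num_code recursive1_comp[OF w])
    moreover have "z \<in> list_encode ` ?M w \<longleftrightarrow> (\<exists>a. num_code I n (pfst a) a \<in> W (w (psnd a)) \<and>
        z = Suc (pr a (list_encode (replicate (n - 1) 0))))" for z
      by (auto simp: image_iff)
    ultimately have "RE (list_encode ` ?M w)" unfolding RE_iff_semirec by (rule semirec_cong)
    then show ?thesis using n by (auto simp: RE_rel_def)
  qed
  \<comment> \<open>The roles are crossed on purpose: membership in \<open>W j\<close> alone yields
    provability, membership in \<open>W i\<close> alone yields refutability.\<close>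
  obtain \<phi> where "strongly_separates L T I n \<phi> (?M psnd - ?M pfst) (?M pfst - ?M psnd)"
    using sep[OF M M] recursive1_pfst[OF recursive1_id] recursive1_psnd[OF recursive1_id] by blast
  then have \<phi>: "fm_in L \<phi>" "fv \<phi> = {..<n}"
    and pos: "\<And>a. ?t a \<in> ?M psnd - ?M pfst \<Longrightarrow> provable L T (num_inst I \<phi> (?t a))"
    and neg: "\<And>a. ?t a \<in> ?M pfst - ?M psnd \<Longrightarrow> provable L T (Neg (num_inst I \<phi> (?t a)))"
    using n unfolding strongly_separates_def by auto
  define e where "e = gn \<phi>"
  define f where "f i j = num_code I n e (pr e (pr i j))" for i j
  let ?\<theta> = "\<lambda>i j. num_inst I \<phi> (?t (pr e (pr i j)))"
  have f: "f i j = gn (?\<theta> i j)" for i j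
    unfolding f_def using num_code[OF n] by (simp add: e_def)
  have \<theta>: "sentence L (?\<theta> i j)" for i j
    using \<phi> n by (intro sentence_num_inst[OF I]) auto
  \<comment> \<open>The self-reference: since \<open>e\<close> is the code of the separating
    formula, the instance tested by the relation is that formula at this very tuple, with code
    \<open>f i j\<close>.\<close>
  have M_iff: "?t (pr e (pr i j)) \<in> ?M w \<longleftrightarrow> f i j \<in> W (w (pr i j))" for i j w
    by (simp add: f_def)
  \<comment> \<open>With \<open>e\<close> now a constant, \<open>f\<close> is a recursive function
    of the pair \<open>z\<close> of the two indices.\<close>
  have "recursive1 (\<lambda>z. num_code I n e (pr e z))"
    by (intro recursive1_num_code recursive1_basic)
  then have "recursive2 f" unfolding recursive2_def recursive1_def f_def by blast
  moreover have "f i j \<notin> W i \<union> W j"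
    if A: "provables L T \<subseteq> W i" and B: "refutables L T \<subseteq> W j" and disj: "W i \<inter> W j = {}" for i j
  proof -
    have "f i j \<notin> W i"
    proof
      assume fi: "f i j \<in> W i"
      then have "f i j \<notin> W j" using disj by blast
      then have "provable L T (Neg (?\<theta> i j))" by (intro neg) (simp only: M_iff Diff_iff pfst_pr psnd_pr fi, simp)
      then have "f i j \<in> W j" using B \<theta> f unfolding refutables_def by blast
      then show False using fi disj by blast
    qed
    moreover have "f i j \<notin> W j"
    proof
      assume fj: "f i j \<in> W j"
      then have "f i j \<notin> W i" using disj by blast
      then have "provable L T (?\<theta> i j)" by (intro pos) (simp only: M_iff Diff_iff pfst_pr psnd_pr fj, simp)
      then have "f i j \<in> W i" using A \<theta> f unfolding provables_def by blast
      then show False using fj disj by blast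
    qed
    ultimately show ?thesis by blast
  qed
  ultimately show ?thesis
    unfolding EI_theory_def effectively_inseparable_def
    using RE_provables[OF RE] RE_refutables[OF RE] provables_refutables_disjoint[OF con] by blast
qed

text \<open>The second half reduces to the first by taking \<open>Rosser\<close> at the given
  \<open>n\<close>.\<close>

theorem theorem3p9:
  fixes L :: lang and T :: "fm set" and n :: nat
  assumes "RE_theory L T" and "consistent L T" and "n \<ge> 1"
  shows "(n_Rosser L T n \<longrightarrow> EI_theory L T) \<and> (Rosser L T \<longrightarrow> EI_theory L T)"
  using n_Rosser_imp_EI[OF assms] assms(3) unfolding Rosser_def by blast

end
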